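(* Let $1/2\le\mu<\infty$ and $1/2\le\nu\le\infty$, let $\sigma\in S^\mu_\nu(\mathbb{R}^d)$, and let $g\in S^{1/2}_{1/2}(\mathbb{R}^d)$. Write $z=(x,\xi)$, $w=(y,\eta)\in\mathbb{R}^{2d}$. If $\nu=\infty$, there are constants $C,\varepsilon>0$ such that $$|\langle\sigma(D_x)\pi(z)g,\pi(w)g\rangle|\le Ce^{-\varepsilon|w-z|^{1/\mu}},\qquad z,w\in\mathbb{R}^{2d}.$$ If $1/2\le\nu<\infty$, there are constants $C,\varepsilon>0$ such that $$|\langle\sigma(D_x)\pi(z)g,\pi(w)g\rangle|\le Ce^{-\varepsilon(|\xi|^2+|\eta|^2)^{\rho/2}}e^{-\varepsilon|x-y|^{1/\mu}},\qquad z,w\in\mathbb{R}^{2d},$$ with $\rho=\min\left(\frac1\nu,\frac1\mu\right)$.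
   Context: For $0\le\mu<\infty$, $0\le\nu\le\infty$, $f\in S^\mu_\nu(\mathbb{R}^d)$ means $f\in\mathcal{C}^\infty(\mathbb{R}^d)$ and there are $C,\varepsilon>0$ with $|\partial^\alpha f(\xi)|\le C^{|\alpha|+1}(\alpha!)^\mu e^{-\varepsilon|\xi|^{1/\nu}}$ for all $\xi\in\mathbb{R}^d$, $\alpha\in\mathbb{N}^d$; for $\nu=\infty$ one understands $1/\nu=0$ and $\varepsilon=0$. Fourier transform: $\widehat f(\xi)=\int f(x)e^{-2\pi i x\cdot\xi}dx$; $\sigma(D_x)f=\mathcal{F}^{-1}(\sigma\widehat f)$. Time-frequency shifts: $\pi(x,\xi)f(t)=e^{2\pi i\xi\cdot t}f(t-x)$. $\langle\cdot,\cdot\rangle$ is the $L^2(\mathbb{R}^d)$ inner product. *)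

theory Defs
  imports "HOL-Analysis.Analysis"
begin

definition partial_deriv ::
    "'d::finite \<Rightarrow> (real ^ 'd \<Rightarrow> complex) \<Rightarrow> real ^ 'd \<Rightarrow> complex" where
  "partial_deriv i f x = frechet_derivative f (at x) (axis i 1)"

text \<open>\<open>\<C>\<^sup>\<infinity>\<close>: every iterated partial derivative, \<open>f\<close> itself included (empty list), is
  differentiable, hence also continuous.\<close>

definition smooth :: "(real ^ 'd::finite \<Rightarrow> complex) \<Rightarrow> bool" where
  "smooth f \<longleftrightarrow> (\<forall>is. foldr partial_deriv is f differentiable_on UNIV)"

text \<open>The iterated derivative \<open>\<partial>\<^sup>\<alpha>\<close> for a multi-index \<open>\<alpha>\<close>. The partial derivatives are taken
  in the order of an arbitrary but fixed enumeration of the coordinates; by the symmetry of mixed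
  derivatives the order is irrelevant for smooth functions.\<close>

definition multi_deriv ::
    "('d::finite \<Rightarrow> nat) \<Rightarrow> (real ^ 'd \<Rightarrow> complex) \<Rightarrow> real ^ 'd \<Rightarrow> complex" where
  "multi_deriv \<alpha> f =
     foldr (\<lambda>i. partial_deriv i ^^ \<alpha> i) (SOME is. distinct is \<and> set is = UNIV) f"

definition multi_order :: "('d::finite \<Rightarrow> nat) \<Rightarrow> nat" where
  "multi_order \<alpha> = (\<Sum>i\<in>UNIV. \<alpha> i)"

definition multi_fact :: "('d::finite \<Rightarrow> nat) \<Rightarrow> real" where
  "multi_fact \<alpha> = (\<Prod>i\<in>UNIV. fact (\<alpha> i))"

text \<open>The Gelfand--Shilov space \<open>S\<^sup>\<mu>\<^sub>\<nu>(\<real>\<^sup>d)\<close>. For \<open>\<nu> = \<infinity>\<close> one reads \<open>1/\<nu> = 0\<close> and \<open>\<epsilon> = 0\<close>, so there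
  is no decay factor. The definition is meant for \<open>\<mu> \<ge> 0\<close> and \<open>0 < \<nu> \<le> \<infinity>\<close>; at \<open>\<nu> = 0\<close> the
  exponent \<open>1/\<nu>\<close> has no meaning as a real number.\<close>

definition gelfand_shilov :: "real \<Rightarrow> ereal \<Rightarrow> (real ^ 'd::finite \<Rightarrow> complex) set" where
  "gelfand_shilov \<mu> \<nu> = {f. smooth f \<and>
     (\<exists>C>0. \<exists>\<epsilon>>0. \<forall>\<alpha> \<xi>. norm (multi_deriv \<alpha> f \<xi>) \<le>
        C ^ (multi_order \<alpha> + 1) * multi_fact \<alpha> powr \<mu> *
        (if \<nu> = \<infinity> then 1 else exp (- \<epsilon> * norm \<xi> powr (1 / real_of_ereal \<nu>))))}"

text \<open>For the functions considered here, both Fourier integrals and the \<open>L\<^sup>2\<close> pairing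
  converge absolutely, so no extension by density is needed.\<close>

definition fourier :: "(real ^ 'd::finite \<Rightarrow> complex) \<Rightarrow> real ^ 'd \<Rightarrow> complex" where
  "fourier f \<xi> = (LINT x|lborel. f x * exp (- 2 * pi * \<i> * of_real (x \<bullet> \<xi>)))"

definition inv_fourier :: "(real ^ 'd::finite \<Rightarrow> complex) \<Rightarrow> real ^ 'd \<Rightarrow> complex" where
  "inv_fourier h x = (LINT \<xi>|lborel. h \<xi> * exp (2 * pi * \<i> * of_real (x \<bullet> \<xi>)))"

definition fourier_multiplier ::
    "(real ^ 'd::finite \<Rightarrow> complex) \<Rightarrow> (real ^ 'd \<Rightarrow> complex) \<Rightarrow> real ^ 'd \<Rightarrow> complex" where
  "fourier_multiplier \<sigma> f = inv_fourier (\<lambda>\<xi>. \<sigma> \<xi> * fourier f \<xi>)"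

definition tf_shift ::
    "(real ^ 'd::finite) \<times> (real ^ 'd) \<Rightarrow> (real ^ 'd \<Rightarrow> complex) \<Rightarrow> real ^ 'd \<Rightarrow> complex" where
  "tf_shift = (\<lambda>(x, \<xi>) f t. exp (2 * pi * \<i> * of_real (\<xi> \<bullet> t)) * f (t - x))"

definition L2_inner ::
    "(real ^ 'd::finite \<Rightarrow> complex) \<Rightarrow> (real ^ 'd \<Rightarrow> complex) \<Rightarrow> complex" where
  "L2_inner f h = (LINT t|lborel. f t * cnj (h t))"

end

theory Submission
  imports Defs "HOL-Probability.Characteristic_Functions"
begin

text \<open>Write \<open>\<gamma>\<close> for the Fourier transform of \<open>g\<close>. Because \<open>\<sigma>(D)\<close> is multiplication by \<open>\<sigma>\<close> on the
  frequency side, and time-frequency shifts become frequency-time shifts there, exchanging two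
  integrals gives, up to a factor of modulus one,
  \<open>\<langle>\<sigma>(D) \<pi>(x,\<xi>) g, \<pi>(y,\<eta>) g\<rangle> = \<integral> \<sigma>(\<zeta>) \<gamma>(\<zeta> - \<xi>) cnj (\<gamma>(\<zeta> - \<eta>)) exp (-2\<pi>i \<zeta> \<cdot> (x - y)) d\<zeta>\<close>
  (lemma \<open>norm_L2_inner_multiplier\<close>). This integral is estimated in two independent ways.

  Decay in \<open>x - y\<close>: the integrand without the exponential is Gevrey of order \<open>\<mu>\<close> in \<open>\<zeta>\<close>, that is, its
  derivatives of order \<open>n\<close> grow like \<open>C\<^sup>n (n!)\<^sup>\<mu>\<close>, uniformly in \<open>\<xi>\<close> and \<open>\<eta>\<close>. Integrating by parts
  \<open>n\<close> times bounds the integral by \<open>K C\<^sup>n (n!)\<^sup>\<mu> |x - y|\<^sup>-\<^sup>n\<close>, and the best choice of \<open>n\<close> turns this into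
  \<open>exp (-\<epsilon> |x - y|\<^bsup>1/\<mu>\<^esup>)\<close> (lemma \<open>fourier_decay\<close>).

  Decay in the frequencies: the absolute value of the integrand is at most a constant times
  \<open>exp (-\<epsilon> |\<zeta>|\<^bsup>1/\<nu>\<^esup>) exp (-\<epsilon> |\<zeta> - \<xi>|\<^sup>2) exp (-\<epsilon> |\<zeta> - \<eta>|\<^sup>2)\<close>, where the first factor is missing for
  \<open>\<nu> = \<infinity>\<close>. As \<open>\<xi> - \<eta> = (\<zeta> - \<eta>) - (\<zeta> - \<xi>)\<close> and \<open>\<xi> = \<zeta> - (\<zeta> - \<xi>)\<close>, at least one of the factors is
  small when \<open>\<xi> - \<eta>\<close> (or, for finite \<open>\<nu>\<close>, when \<open>\<xi>\<close> or \<open>\<eta>\<close>) is large.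

  A quantity bounded both by \<open>K e\<^sup>-\<^sup>a\<close> and by \<open>L e\<^sup>-\<^sup>b\<close> is at most \<open>(K + L) e\<^bsup>-(a+b)/2\<^esup>\<close>, so the two estimates
  combine at the price of a smaller \<open>\<epsilon>\<close>. This is why no estimate for derivatives has to keep track of
  the frequencies.

  The first estimate needs that \<open>\<gamma>\<close> is Gevrey of order \<open>1/2 \<le> \<mu>\<close> with Gaussian decay, the second its decay
  (lemma \<open>fourier_gevrey_along\<close>). Both follow from the decay estimate of lemma \<open>fourier_decay\<close>, applied with \<open>\<mu> = 1/2\<close> to
  \<open>x\<^sub>i\<^sup>n g\<close>, whose Fourier transform is a multiple of the \<open>n\<close>-th derivative of \<open>\<gamma>\<close>.

  All derivatives are pure derivatives along one coordinate axis: for the decay of a Fourier transform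
  at \<open>\<zeta>\<close> it suffices to integrate by parts along the axis of the largest coordinate of \<open>\<zeta>\<close>.\<close>

section \<open>Factorial growth and Gaussian weights\<close>

text \<open>Instead of looking for the best \<open>n\<close> one can use all of them at once: the bounds, raised to the power
  \<open>1/s\<close> and weighted by \<open>2\<^sup>-\<^sup>n\<close>, are the terms of an exponential series on the left and of a geometric
  series on the right.\<close>

lemma factorial_growth_imp_stretched_exp:
  fixes a t K C s :: real
  assumes "s > 0" "C > 0" "K \<ge> 0" "t \<ge> 0" "a \<ge> 0"
    and bound: "\<And>n. t ^ n * a \<le> K * C ^ n * fact n powr s"
  shows "a \<le> 2 powr s * K * exp (- (s / (2 * C powr (1/s))) * t powr (1/s))"
proof -
  define b L T D where "b = a powr (1/s)" and "L = K powr (1/s)"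
    and "T = t powr (1/s)" and "D = C powr (1/s)"
  have pos: "D > 0" "b \<ge> 0" "L \<ge> 0" "T \<ge> 0" using assms by (auto simp: D_def b_def L_def T_def)
  have pw: "(y ^ n) powr (1/s) = (y powr (1/s)) ^ n" if "y \<ge> 0" for y :: real and n
    using that by (induction n) (auto simp: powr_mult)
  have root: "T ^ n * b \<le> L * D ^ n * fact n" for n
  proof -
    have "(t ^ n * a) powr (1/s) \<le> (K * C ^ n * fact n powr s) powr (1/s)"
      using assms by (intro powr_mono2 bound) auto
    then show ?thesis
      using assms by (simp add: powr_mult pw powr_powr T_def b_def L_def D_def)
  qed
  have term_le: "b * ((T / (2*D)) ^ n /\<^sub>R fact n) \<le> L * (1/2) ^ n" for n
    using root[of n] pos by (simp add: field_simps power_mult_distrib)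
  have "b * exp (T / (2*D)) = (\<Sum>n. b * ((T / (2*D)) ^ n /\<^sub>R fact n))"
    unfolding exp_def by (rule suminf_mult[OF summable_exp_generic, symmetric])
  also have "\<dots> \<le> (\<Sum>n. L * (1/2) ^ n)"
    by (intro suminf_le term_le summable_mult summable_exp_generic summable_geometric) auto
  also have "\<dots> = 2 * L"
    by (subst suminf_mult) (auto simp: suminf_geometric)
  finally have "b \<le> 2 * L * exp (- (T / (2*D)))"
    by (simp add: exp_minus field_simps)
  then have "b powr s \<le> (2 * L * exp (- (T / (2*D)))) powr s"
    using pos assms by (intro powr_mono2) auto
  moreover have "b powr s = a" "L powr s = K"
    using assms by (simp_all add: b_def L_def powr_powr)
  moreover have "exp (- (T / (2*D))) powr s = exp (- (s / (2 * D)) * T)"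
    by (simp add: powr_def)
  ultimately show ?thesis
    using pos by (simp add: powr_mult D_def T_def)
qed

text \<open>The \<open>n\<close>-th term of the exponential series of \<open>2 \<delta> t\<^sup>2\<close> is at most the whole series; take square
  roots.\<close>

lemma power_le_gaussian:
  fixes t \<delta> :: real
  assumes "\<delta> > 0" "t \<ge> 0"
  shows "t ^ n \<le> (1 / sqrt (2*\<delta>)) ^ n * fact n powr (1/2) * exp (\<delta> * t\<^sup>2)"
proof -
  have "(\<Sum>k\<in>{n}. (2*\<delta>*t\<^sup>2) ^ k /\<^sub>R fact k) \<le> (\<Sum>k. (2*\<delta>*t\<^sup>2) ^ k /\<^sub>R fact k)"
    using assms by (intro sum_le_suminf summable_exp_generic) auto
  then have "(2*\<delta>*t\<^sup>2) ^ n / fact n \<le> exp (2*\<delta>*t\<^sup>2)"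
    by (simp add: exp_def field_simps)
  then have "sqrt ((2*\<delta>*t\<^sup>2) ^ n) \<le> sqrt (fact n * exp (2*\<delta>*t\<^sup>2))"
    by (intro real_sqrt_le_mono) (simp add: field_simps)
  moreover have "sqrt ((2*\<delta>*t\<^sup>2) ^ n) = sqrt (2*\<delta>) ^ n * t ^ n"
    using assms by (simp add: real_sqrt_power real_sqrt_mult power_mult_distrib)
  moreover have "sqrt (exp (2*\<delta>*t\<^sup>2)) = exp (\<delta> * t\<^sup>2)"
    by (rule real_sqrt_unique) (auto simp: power2_eq_square exp_add[symmetric])
  ultimately have "sqrt (2*\<delta>) ^ n * t ^ n \<le> fact n powr (1/2) * exp (\<delta> * t\<^sup>2)"
    by (simp add: real_sqrt_mult powr_half_sqrt)
  then show ?thesis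
    using assms by (simp add: power_divide field_simps)
qed

lemma gaussian_integrable:
  fixes a :: "real ^ 'd::finite"
  assumes "\<delta> > 0"
  shows "integrable lborel (\<lambda>x. exp (- \<delta> * (norm (x - a))\<^sup>2))"
proof -
  have one: "integrable lborel (\<lambda>t::real. exp (- \<delta> * t\<^sup>2))"
  proof -
    have "integrable lborel (\<lambda>t::real. exp (- t\<^sup>2))"
      using has_bochner_integral_even_function[OF gaussian_moment_0]
      by (simp add: has_bochner_integral_iff)
    then have "integrable lborel (\<lambda>t::real. exp (- (0 + sqrt \<delta> * t)\<^sup>2))"
      by (subst lborel_integrable_real_affine_iff) (use assms in auto)
    then show ?thesis using assms by (simp add: power_mult_distrib)
  qed
  have prod: "exp (- \<delta> * (norm x)\<^sup>2) = (\<Prod>b\<in>Basis. exp (- \<delta> * (x \<bullet> b)\<^sup>2))" for x :: "real ^ 'd"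
    by (simp add: exp_sum[symmetric] norm_eq_sqrt_inner euclidean_inner[of x x]
        sum_distrib_left power2_eq_square sum_negf sum_nonneg)
  have "integrable lborel (\<lambda>x::real ^ 'd. exp (- \<delta> * (norm x)\<^sup>2))"
  proof (rule integrableI_bounded)
    have "(\<integral>\<^sup>+x. ennreal (norm (exp (- \<delta> * (norm (x::real^'d))\<^sup>2))) \<partial>lborel)
        = (\<integral>\<^sup>+x. (\<Prod>b\<in>(Basis::(real^'d) set). ennreal (exp (- \<delta> * (x \<bullet> b)\<^sup>2))) \<partial>lborel)"
      by (intro nn_integral_cong) (simp only: prod prod_ennreal[symmetric], simp add: prod_ennreal prod_nonneg abs_of_nonneg)
    also have "\<dots> = (\<Prod>b\<in>(Basis::(real^'d) set). \<integral>\<^sup>+t. ennreal (exp (- \<delta> * t\<^sup>2)) \<partial>lborel)"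
      by (rule nn_integral_lborel_prod) auto
    also have "\<dots> < \<infinity>"
      using one by (simp add: integrable_iff_bounded power_less_top_ennreal)
    finally show "(\<integral>\<^sup>+x. ennreal (norm (exp (- \<delta> * (norm (x::real^'d))\<^sup>2))) \<partial>lborel) < \<infinity>" .
  qed auto
  then have "integrable (distr lborel borel ((+) (-a))) (\<lambda>x::real ^ 'd. exp (- \<delta> * (norm x)\<^sup>2))"
    by (simp add: lborel_distr_plus)
  then show ?thesis by (subst (asm) integrable_distr_eq) auto
qed

lemma lborel_integral_translate:
  fixes f :: "'a::euclidean_space \<Rightarrow> 'b::{banach,second_countable_topology}"
  assumes [measurable]: "f \<in> borel_measurable borel"
  shows "(LINT x|lborel. f (x + a)) = (LINT x|lborel. f x)"
proof -
  have "(LINT x|lborel. f x) = (LINT x|distr lborel borel ((+) a). f x)"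
    by (simp add: lborel_distr_plus)
  also have "\<dots> = (LINT x|lborel. f (x + a))"
    by (subst integral_distr) (auto simp: add.commute)
  finally show ?thesis ..
qed

lemma lborel_integrable_translate:
  fixes f :: "'a::euclidean_space \<Rightarrow> 'b::{banach,second_countable_topology}"
  assumes "integrable lborel f"
  shows "integrable lborel (\<lambda>x. f (x + a))"
proof -
  have "integrable (distr lborel borel ((+) a)) f"
    using assms by (simp add: lborel_distr_plus)
  then show ?thesis
    by (subst (asm) integrable_distr_eq) (use assms in \<open>auto simp: add.commute\<close>)
qed

section \<open>Gevrey bounds along a coordinate axis\<close>

definition derivs_along :: "'d::finite \<Rightarrow> (nat \<Rightarrow> real ^ 'd \<Rightarrow> complex) \<Rightarrow> bool" where
  "derivs_along i F \<longleftrightarrow> (\<forall>n. F n \<in> borel_measurable borel \<and>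
     (\<forall>x. ((\<lambda>t. F n (x + t *\<^sub>R axis i 1)) has_vector_derivative F (Suc n) x) (at 0)))"

text \<open>Gevrey regularity of order \<open>s\<close> in one direction; the weight \<open>w\<close> carries the decay in space. The constants \<open>C\<close> and \<open>w\<close> are kept separate and explicit, because the
  decay of a Fourier transform must be uniform over families of functions that share \<open>C\<close>.\<close>

definition gevrey_along ::
    "'d::finite \<Rightarrow> real \<Rightarrow> real \<Rightarrow> (real ^ 'd \<Rightarrow> real) \<Rightarrow> (real ^ 'd \<Rightarrow> complex) \<Rightarrow> bool" where
  "gevrey_along i s C w f \<longleftrightarrow> (\<exists>F. F 0 = f \<and> derivs_along i F \<and>
     (\<forall>n x. norm (F n x) \<le> C ^ n * fact n powr s * w x))"

lemma derivs_along_shifted: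
  assumes "derivs_along i F"
  shows "((\<lambda>t. F n (x + t *\<^sub>R axis i 1)) has_vector_derivative F (Suc n) (x + t *\<^sub>R axis i 1)) (at t)"
proof -
  have "((\<lambda>r. F n ((x + t *\<^sub>R axis i 1) + r *\<^sub>R axis i 1)) has_vector_derivative
      F (Suc n) (x + t *\<^sub>R axis i 1)) (at ((\<lambda>u. u - t) t))"
    using assms by (simp add: derivs_along_def)
  then have "((\<lambda>r. F n ((x + t *\<^sub>R axis i 1) + r *\<^sub>R axis i 1)) \<circ> (\<lambda>u. u - t) has_vector_derivative
      1 *\<^sub>R F (Suc n) (x + t *\<^sub>R axis i 1)) (at t)"
    by (intro vector_diff_chain_at) (auto intro!: derivative_eq_intros)
  then show ?thesis by (simp add: o_def algebra_simps)
qed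

lemma gevrey_along_bound:
  assumes "gevrey_along i s C w f"
  shows "norm (f x) \<le> w x"
  using assms unfolding gevrey_along_def
  by (metis fact_0 mult_1 power_0 powr_one_eq_one)

lemma gevrey_along_weight_nonneg:
  "gevrey_along i s C w f \<Longrightarrow> 0 \<le> w x"
  using gevrey_along_bound[of i s C w f x] norm_ge_zero[of "f x"] by linarith

lemma gevrey_along_measurable:
  "gevrey_along i s C w f \<Longrightarrow> f \<in> borel_measurable borel"
  unfolding gevrey_along_def derivs_along_def by auto

lemma gevrey_along_mono:
  assumes "gevrey_along i s C w f" "s \<le> s'" "0 \<le> C" "\<And>x. w x \<le> w' x"
  shows "gevrey_along i s' C w' f"
proof -
  obtain F where F: "F 0 = f" "derivs_along i F"
      "\<And>n x. norm (F n x) \<le> C ^ n * fact n powr s * w x"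
    using assms by (auto simp: gevrey_along_def)
  have w: "0 \<le> w x" for x using assms(1) by (rule gevrey_along_weight_nonneg)
  have "C ^ n * fact n powr s * w x \<le> C ^ n * fact n powr s' * w' x" for n x
    using assms w by (intro mult_mono mult_left_mono powr_mono) auto
  then show ?thesis using F unfolding gevrey_along_def by (blast intro: order_trans)
qed

lemma gevrey_along_translate:
  assumes "gevrey_along i s C w f"
  shows "gevrey_along i s C (\<lambda>x. w (x - a)) (\<lambda>x. f (x - a))"
proof -
  obtain F where F: "F 0 = f" "derivs_along i F"
      "\<And>n x. norm (F n x) \<le> C ^ n * fact n powr s * w x"
    using assms by (auto simp: gevrey_along_def)
  have [measurable]: "F n \<in> borel_measurable borel" for n
    using F(2) by (simp add: derivs_along_def)
  have "((\<lambda>t. F n (x + t *\<^sub>R axis i 1 - a)) has_vector_derivative F (Suc n) (x - a)) (at 0)" for n x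
    using derivs_along_shifted[OF F(2), of n "x - a" 0] by (simp add: algebra_simps)
  then have "derivs_along i (\<lambda>n x. F n (x - a))"
    by (simp add: derivs_along_def)
  then show ?thesis unfolding gevrey_along_def
    using F by (intro exI[of _ "\<lambda>n x. F n (x - a)"]) auto
qed

lemma gevrey_along_cnj:
  assumes "gevrey_along i s C w f"
  shows "gevrey_along i s C w (\<lambda>x. cnj (f x))"
proof -
  obtain F where F: "F 0 = f" "derivs_along i F"
      "\<And>n x. norm (F n x) \<le> C ^ n * fact n powr s * w x"
    using assms by (auto simp: gevrey_along_def)
  have [measurable]: "F n \<in> borel_measurable borel" for n
    using F(2) by (simp add: derivs_along_def)
  have "((\<lambda>t. cnj (F n (x + t *\<^sub>R axis i 1))) has_vector_derivative cnj (F (Suc n) x)) (at 0)" for n x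
    using derivs_along_shifted[OF F(2), of n x 0] by (intro has_vector_derivative_cnj) simp
  moreover have "(\<lambda>x. cnj (F n x)) \<in> borel_measurable borel" for n
    by (rule measurable_compose[OF _ borel_measurable_continuous_onI[of cnj]])
      (auto intro: continuous_intros)
  ultimately have "derivs_along i (\<lambda>n x. cnj (F n x))"
    by (simp add: derivs_along_def)
  then show ?thesis unfolding gevrey_along_def
    using F by (intro exI[of _ "\<lambda>n x. cnj (F n x)"]) auto
qed

text \<open>The algebraic half of the induction step of Leibniz' rule, by Pascal's identity.\<close>

lemma leibniz_sum_Suc:
  fixes a b :: "nat \<Rightarrow> 'a::comm_ring_1"
  shows "(\<Sum>k\<le>n. of_nat (n choose k) * (a (Suc k) * b (n - k) + a k * b (Suc (n - k))))
    = (\<Sum>k\<le>Suc n. of_nat (Suc n choose k) * (a k * b (Suc n - k)))"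
proof -
  have "(\<Sum>k\<le>Suc n. of_nat (Suc n choose k) * (a k * b (Suc n - k)))
      = a 0 * b (Suc n) + (\<Sum>k\<le>n. of_nat ((n choose k) + (n choose Suc k)) * (a (Suc k) * b (n - k)))"
    by (subst sum.atMost_Suc_shift) simp
  also have "(\<Sum>k\<le>n. of_nat ((n choose k) + (n choose Suc k)) * (a (Suc k) * b (n - k)))
      = (\<Sum>k\<le>n. of_nat (n choose k) * (a (Suc k) * b (n - k)))
       + (\<Sum>k\<le>n. of_nat (n choose Suc k) * (a (Suc k) * b (n - k)))"
    by (simp add: algebra_simps sum.distrib)
  also have "a 0 * b (Suc n) + (\<dots>) = (\<Sum>k\<le>n. of_nat (n choose k) * (a (Suc k) * b (n - k)))
       + (\<Sum>k\<le>Suc n. of_nat (n choose k) * (a k * b (Suc n - k)))"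
    by (subst sum.atMost_Suc_shift) (simp add: binomial_eq_0)
  also have "(\<Sum>k\<le>Suc n. of_nat (n choose k) * (a k * b (Suc n - k)))
      = (\<Sum>k\<le>n. of_nat (n choose k) * (a k * b (Suc (n - k))))"
    by (auto simp: binomial_eq_0 Suc_diff_le intro!: sum.cong)
  finally show ?thesis by (simp add: algebra_simps sum.distrib)
qed

lemma fact_mult_fact_le: "k \<le> n \<Longrightarrow> fact k * fact (n - k) \<le> (fact n :: real)"
proof -
  assume "k \<le> n"
  then have "fact k * fact (n - k) * (1::real) \<le> fact k * fact (n - k) * real (n choose k)"
    by (intro mult_left_mono) (auto simp: Suc_le_eq)
  also have "\<dots> = fact n"
    using binomial_fact_lemma[OF \<open>k \<le> n\<close>] by (metis of_nat_fact of_nat_mult)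
  finally show ?thesis by simp
qed

text \<open>Leibniz' rule. Since \<open>k! (n - k)! \<le> n!\<close>, the factorials of both factors are absorbed into \<open>(n!)\<^sup>s\<close>,
  and what remains is the binomial expansion of \<open>(C + D)\<^sup>n\<close>.\<close>

lemma gevrey_along_mult:
  assumes f: "gevrey_along i s C v f" and g: "gevrey_along i s D w g"
    and "s \<ge> 0" "C \<ge> 0" "D \<ge> 0"
  shows "gevrey_along i s (C + D) (\<lambda>x. v x * w x) (\<lambda>x. f x * g x)"
proof -
  obtain F where F: "F 0 = f" "derivs_along i F"
      "\<And>n x. norm (F n x) \<le> C ^ n * fact n powr s * v x"
    using f by (auto simp: gevrey_along_def)
  obtain G where G: "G 0 = g" "derivs_along i G"
      "\<And>n x. norm (G n x) \<le> D ^ n * fact n powr s * w x"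
    using g by (auto simp: gevrey_along_def)
  have v: "0 \<le> v x" and w: "0 \<le> w x" for x
    using f g by (auto intro: gevrey_along_weight_nonneg)
  have [measurable]: "F n \<in> borel_measurable borel" "G n \<in> borel_measurable borel" for n
    using F(2) G(2) by (simp_all add: derivs_along_def)
  define H where "H n x = (\<Sum>k\<le>n. of_nat (n choose k) * (F k x * G (n - k) x))" for n x
  have "((\<lambda>t. H n (x + t *\<^sub>R axis i 1)) has_vector_derivative H (Suc n) x) (at 0)" for n x
  proof -
    have dF: "((\<lambda>t. F k (x + t *\<^sub>R axis i 1)) has_vector_derivative F (Suc k) x) (at 0)"
      and dG: "((\<lambda>t. G k (x + t *\<^sub>R axis i 1)) has_vector_derivative G (Suc k) x) (at 0)" for k
      using F(2) G(2) by (auto simp: derivs_along_def)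
    have "((\<lambda>t. H n (x + t *\<^sub>R axis i 1)) has_vector_derivative
        (\<Sum>k\<le>n. of_nat (n choose k) * (F k (x + 0 *\<^sub>R axis i 1) * G (Suc (n - k)) x
            + F (Suc k) x * G (n - k) (x + 0 *\<^sub>R axis i 1)))) (at 0)"
      unfolding H_def
      by (intro has_vector_derivative_sum has_vector_derivative_mult_right has_vector_derivative_mult dF dG)
    also have "(\<Sum>k\<le>n. of_nat (n choose k) * (F k (x + 0 *\<^sub>R axis i 1) * G (Suc (n - k)) x
            + F (Suc k) x * G (n - k) (x + 0 *\<^sub>R axis i 1))) = H (Suc n) x"
      using leibniz_sum_Suc[of n "\<lambda>k. F k x" "\<lambda>k. G k x"]
      by (simp add: H_def add.commute del: sum.atMost_Suc)
    finally show ?thesis .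
  qed
  moreover have "H n \<in> borel_measurable borel" for n
    unfolding H_def[abs_def] by measurable
  ultimately have "derivs_along i H" by (simp add: derivs_along_def)
  moreover have "norm (H n x) \<le> (C + D) ^ n * fact n powr s * (v x * w x)" for n x
  proof -
    have "norm (H n x) \<le> (\<Sum>k\<le>n. real (n choose k) * (norm (F k x) * norm (G (n - k) x)))"
      unfolding H_def by (rule order_trans[OF norm_sum]) (simp add: norm_mult)
    also have "\<dots> \<le> (\<Sum>k\<le>n. (real (n choose k) * C ^ k * D ^ (n - k)) * (fact n powr s * (v x * w x)))"
    proof (rule sum_mono)
      fix k assume "k \<in> {..n}"
      then have "fact k powr s * fact (n - k) powr s \<le> (fact n :: real) powr s"
        using \<open>s \<ge> 0\<close> by (subst powr_mult[symmetric]) (auto intro!: powr_mono2 fact_mult_fact_le)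
      have "norm (F k x) * norm (G (n - k) x)
          \<le> (C ^ k * fact k powr s * v x) * (D ^ (n - k) * fact (n - k) powr s * w x)"
        using assms v by (intro mult_mono F G) auto
      also have "\<dots> = (C ^ k * D ^ (n - k)) * ((fact k powr s * fact (n - k) powr s) * (v x * w x))"
        by (simp add: mult_ac)
      also have "\<dots> \<le> (C ^ k * D ^ (n - k)) * (fact n powr s * (v x * w x))"
        using assms v w by (intro mult_left_mono mult_right_mono) (auto intro: \<open>_ \<le> fact n powr s\<close>)
      finally have "real (n choose k) * (norm (F k x) * norm (G (n - k) x))
          \<le> real (n choose k) * ((C ^ k * D ^ (n - k)) * (fact n powr s * (v x * w x)))"
        by (rule mult_left_mono) simp
      then show "real (n choose k) * (norm (F k x) * norm (G (n - k) x))
          \<le> (real (n choose k) * C ^ k * D ^ (n - k)) * (fact n powr s * (v x * w x))"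
        by (simp add: mult.assoc)
    qed
    also have "\<dots> = (C + D) ^ n * fact n powr s * (v x * w x)"
      by (simp add: binomial_ring sum_distrib_right mult.assoc)
    finally show ?thesis .
  qed
  moreover have "H 0 = (\<lambda>x. f x * g x)" by (auto simp: H_def F G)
  ultimately show ?thesis unfolding gevrey_along_def by blast
qed

lemma smooth_derivs_along:
  assumes "smooth f"
  shows "derivs_along i (\<lambda>n. (partial_deriv i ^^ n) f)"
proof -
  have fold: "foldr partial_deriv (replicate n i) f = (partial_deriv i ^^ n) f" for n
    by (induction n) auto
  have diff: "(partial_deriv i ^^ n) f differentiable (at x)" for n x
    using assms fold[of n] unfolding smooth_def differentiable_on_def
    by (metis UNIV_I)
  then have cont: "continuous_on UNIV ((partial_deriv i ^^ n) f)" for n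
    by (auto simp: continuous_on_eq_continuous_at differentiable_imp_continuous_within)
  have "((\<lambda>t. (partial_deriv i ^^ n) f (x + t *\<^sub>R axis i 1)) has_vector_derivative
      (partial_deriv i ^^ Suc n) f x) (at 0)" for n x
  proof -
    let ?h = "(partial_deriv i ^^ n) f"
    let ?D = "frechet_derivative ?h (at x)"
    have D: "(?h has_derivative ?D) (at (x + 0 *\<^sub>R axis i 1))"
      using diff[of n x] by (simp add: frechet_derivative_works)
    have "((\<lambda>t. x + t *\<^sub>R axis i 1) has_derivative (\<lambda>t. t *\<^sub>R axis i (1::real))) (at 0)"
      by (auto intro!: derivative_eq_intros)
    from has_derivative_compose[OF this D]
    have "((\<lambda>t. ?h (x + t *\<^sub>R axis i 1)) has_derivative (\<lambda>t. ?D (t *\<^sub>R axis i 1))) (at 0)" .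
    moreover have "?D (t *\<^sub>R axis i 1) = t *\<^sub>R ?D (axis i 1)" for t
      using D by (simp add: has_derivative_def bounded_linear.linear linear_cmul)
    ultimately show ?thesis
      by (simp add: has_vector_derivative_def partial_deriv_def)
  qed
  then show ?thesis
    using cont by (simp add: derivs_along_def borel_measurable_continuous_onI)
qed

text \<open>The chosen enumeration contains \<open>i\<close> exactly once, and every other coordinate contributes zero
  derivatives.\<close>

lemma multi_deriv_single:
  "multi_deriv (\<lambda>j. if j = i then n else 0) f = (partial_deriv i ^^ n) f"
proof -
  define xs where "xs = (SOME xs. distinct xs \<and> set xs = (UNIV :: 'a set))"
  have "distinct xs \<and> set xs = UNIV"
    unfolding xs_def by (rule someI_ex) (metis finite_distinct_list finite)
  moreover have "distinct xs \<Longrightarrow> foldr (\<lambda>j. partial_deriv j ^^ (if j = i then n else 0)) xs f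
      = (if i \<in> set xs then (partial_deriv i ^^ n) f else f)"
    for xs :: "'a list"
    by (induction xs) auto
  ultimately show ?thesis by (simp add: multi_deriv_def xs_def[symmetric])
qed

definition decay_weight :: "real \<Rightarrow> ereal \<Rightarrow> real ^ 'd::finite \<Rightarrow> real" where
  "decay_weight \<epsilon> \<nu> \<xi> = (if \<nu> = \<infinity> then 1 else exp (- \<epsilon> * norm \<xi> powr (1 / real_of_ereal \<nu>)))"

lemma gelfand_shilov_gevrey_along:
  fixes f :: "real ^ 'd::finite \<Rightarrow> complex"
  assumes "f \<in> gelfand_shilov \<mu> \<nu>"
  obtains C \<epsilon> where "C > 0" "\<epsilon> > 0" "\<And>i. gevrey_along i \<mu> C (\<lambda>x. C * decay_weight \<epsilon> \<nu> x) f"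
proof -
  from assms obtain C \<epsilon> where C: "C > 0" "\<epsilon> > 0" and sm: "smooth f"
    and le: "\<And>\<alpha> x. norm (multi_deriv \<alpha> f x) \<le>
        C ^ (multi_order \<alpha> + 1) * multi_fact \<alpha> powr \<mu> * decay_weight \<epsilon> \<nu> x"
    unfolding gelfand_shilov_def decay_weight_def by blast
  have "norm ((partial_deriv i ^^ n) f x) \<le> C ^ n * fact n powr \<mu> * (C * decay_weight \<epsilon> \<nu> x)" for i n x
  proof -
    have "multi_order (\<lambda>j. if j = i then n else 0) = n"
      by (simp add: multi_order_def)
    moreover have "multi_fact (\<lambda>j. if j = i then n else 0) = fact n"
      by (simp add: multi_fact_def if_distrib[of fact] cong: if_cong)
    ultimately show ?thesis
      using le[of "\<lambda>j. if j = i then n else 0" x] by (simp add: multi_deriv_single mult_ac)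
  qed
  then have "gevrey_along i \<mu> C (\<lambda>x. C * decay_weight \<epsilon> \<nu> x) f" for i
    using smooth_derivs_along[OF sm, of i] unfolding gevrey_along_def
    by (intro exI[of _ "\<lambda>n. (partial_deriv i ^^ n) f"]) auto
  with C show thesis by (rule that)
qed

text \<open>The growth of a monomial is absorbed by \<open>exp (\<delta> |x|\<^sup>2)\<close> at the price of \<open>(n!)\<^bsup>1/2\<^esup>\<close>, which is
  the factor that order \<open>1/2\<close> allows for the \<open>n\<close>-th derivative of a Fourier transform. For the
  derivatives of order \<open>k\<close>, the factor \<open>k! ((n - k)!)\<^bsup>1/2\<^esup>\<close> is split as
  \<open>(k!)\<^bsup>1/2\<^esup> (k! (n - k)!)\<^bsup>1/2\<^esup> \<le> (k!)\<^bsup>1/2\<^esup> (n!)\<^bsup>1/2\<^esup>\<close>.\<close>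

lemma gevrey_along_monomial:
  fixes i j :: "'d::finite"
  assumes "\<delta> > 0" and c: "c \<ge> 1" "c \<ge> 1 / sqrt (2*\<delta>)"
  shows "gevrey_along j (1/2) 1 (\<lambda>x. (2*c) ^ n * fact n powr (1/2) * exp (\<delta> * (norm x)\<^sup>2))
    (\<lambda>x. of_real ((x $ i) ^ n))"
proof -
  \<comment> \<open>For \<open>k > n\<close> the binomial coefficient vanishes, so the formula also covers the derivatives beyond
    the degree.\<close>
  define F :: "nat \<Rightarrow> real ^ 'd \<Rightarrow> complex" where
    "F k x = (if j = i \<or> k = 0 then of_real (fact k * real (n choose k) * (x $ i) ^ (n - k)) else 0)" for k x
  have "((\<lambda>t. F k (x + t *\<^sub>R axis j 1)) has_vector_derivative F (Suc k) x) (at 0)" for k x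
  proof (cases "j = i")
    case True
    have "(n - k) * (n choose k) = Suc k * (n choose Suc k)"
      by (simp only: binomial_absorb_comp binomial_absorption)
    then have "real (n - k) * real (n choose k) = real (Suc k) * real (n choose Suc k)"
      by (metis of_nat_mult)
    then have "fact k * (real (n - k) * real (n choose k)) * y
        = fact k * (real (Suc k) * real (n choose Suc k)) * y" for y :: real
      by (simp only:)
    then have coeff: "fact k * real (n choose k) * (real (n - k) * y)
        = fact (Suc k) * real (n choose Suc k) * y" for y :: real
      unfolding fact_Suc by (simp only: mult_ac)
    have "((\<lambda>t. fact k * real (n choose k) * (x $ i + t) ^ (n - k)) has_real_derivative
        fact k * real (n choose k) * (real (n - k) * (x $ i) ^ (n - Suc k))) (at 0)"
      by (rule derivative_eq_intros refl | simp)+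
    then have "((\<lambda>t. fact k * real (n choose k) * (x $ i + t) ^ (n - k)) has_real_derivative
        fact (Suc k) * real (n choose Suc k) * (x $ i) ^ (n - Suc k)) (at 0)"
      unfolding coeff .
    then have "((\<lambda>t. complex_of_real (fact k * real (n choose k) * (x $ i + t) ^ (n - k))) has_vector_derivative
        of_real (fact (Suc k) * real (n choose Suc k) * (x $ i) ^ (n - Suc k))) (at 0)"
      by (rule has_vector_derivative_of_real)
    with True show ?thesis by (simp add: F_def axis_def)
  next
    case False
    then show ?thesis by (cases "k = 0") (simp_all add: F_def axis_def)
  qed
  moreover have "F k \<in> borel_measurable borel" for k
    unfolding F_def[abs_def] by measurable
  ultimately have "derivs_along j F" by (simp add: derivs_along_def)
  moreover have "norm (F k x) \<le> 1 ^ k * fact k powr (1/2) * ((2*c) ^ n * fact n powr (1/2) * exp (\<delta> * (norm x)\<^sup>2))"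
    for k x
  proof (cases "k \<le> n")
    case True
    have "real (n choose k) \<le> 2 ^ n"
      using binomial_le_pow2[of n k] by (metis of_nat_le_iff of_nat_numeral of_nat_power)
    have "\<bar>x $ i\<bar> ^ (n - k) \<le> (1 / sqrt (2*\<delta>)) ^ (n - k) * fact (n - k) powr (1/2) * exp (\<delta> * \<bar>x $ i\<bar>\<^sup>2)"
      using assms by (intro power_le_gaussian) auto
    also have "\<dots> \<le> c ^ n * fact (n - k) powr (1/2) * exp (\<delta> * (norm x)\<^sup>2)"
    proof (intro mult_mono)
      have "(1 / sqrt (2*\<delta>)) ^ (n - k) \<le> c ^ (n - k)"
        using assms by (intro power_mono) auto
      also have "\<dots> \<le> c ^ n" using c by (intro power_increasing) auto
      finally show "(1 / sqrt (2*\<delta>)) ^ (n - k) \<le> c ^ n" .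
      have "\<bar>x $ i\<bar>\<^sup>2 \<le> (norm x)\<^sup>2"
        by (intro power_mono component_le_norm_cart) auto
      then show "exp (\<delta> * \<bar>x $ i\<bar>\<^sup>2) \<le> exp (\<delta> * (norm x)\<^sup>2)" using assms by simp
    qed (use c in auto)
    finally have pow: "\<bar>x $ i\<bar> ^ (n - k) \<le> c ^ n * fact (n - k) powr (1/2) * exp (\<delta> * (norm x)\<^sup>2)" .
    have "(fact k :: real) * fact (n - k) powr (1/2) = fact k powr (1/2) * (fact k * fact (n - k)) powr (1/2)"
      by (simp add: powr_mult powr_half_sqrt mult.assoc[symmetric])
    also have "\<dots> \<le> fact k powr (1/2) * (fact n :: real) powr (1/2)"
      using True by (intro mult_left_mono powr_mono2 fact_mult_fact_le) auto
    finally have fac: "(fact k :: real) * fact (n - k) powr (1/2) \<le> fact k powr (1/2) * (fact n :: real) powr (1/2)" .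
    have "norm (F k x) \<le> fact k * real (n choose k) * \<bar>x $ i\<bar> ^ (n - k)"
      by (simp add: F_def norm_mult norm_power abs_mult power_abs)
    also have "\<dots> \<le> fact k * 2 ^ n * (c ^ n * fact (n - k) powr (1/2) * exp (\<delta> * (norm x)\<^sup>2))"
      using \<open>real (n choose k) \<le> 2 ^ n\<close> pow by (intro mult_mono) auto
    also have "\<dots> = (2*c) ^ n * exp (\<delta> * (norm x)\<^sup>2) * (fact k * fact (n - k) powr (1/2))"
      by (simp add: power_mult_distrib)
    also have "\<dots> \<le> (2*c) ^ n * exp (\<delta> * (norm x)\<^sup>2) * (fact k powr (1/2) * fact n powr (1/2))"
      using c by (intro mult_left_mono fac) auto
    finally show ?thesis by (simp add: mult_ac)
  next
    case False
    then have "F k x = 0" by (simp add: F_def binomial_eq_0)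
    then show ?thesis using c by simp
  qed
  moreover have "F 0 = (\<lambda>x. of_real ((x $ i) ^ n))" by (auto simp: F_def)
  ultimately show ?thesis unfolding gevrey_along_def by blast
qed

section \<open>Decay of Fourier transforms of Gevrey functions\<close>

lemma has_vector_derivative_at_0_quotient:
  assumes "(f has_vector_derivative d) (at 0)"
  shows "((\<lambda>t. (f t - f 0) /\<^sub>R t) \<longlongrightarrow> d) (at 0)"
proof -
  have "((\<lambda>t. norm (f t - f 0 - t *\<^sub>R d) / norm t) \<longlongrightarrow> 0) (at 0)"
    using assms unfolding has_vector_derivative_def has_derivative_at by simp
  then have "((\<lambda>t. norm ((f t - f 0) /\<^sub>R t - d)) \<longlongrightarrow> 0) (at 0)"
  proof (rule Lim_transform_eventually)
    have "norm (f t - f 0 - t *\<^sub>R d) / norm t = norm ((f t - f 0) /\<^sub>R t - d)" if "t \<noteq> 0" for t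
    proof -
      have "(f t - f 0) /\<^sub>R t - d = (f t - f 0 - t *\<^sub>R d) /\<^sub>R t"
        using that by (simp add: scaleR_diff_right)
      then show ?thesis by (simp add: divide_inverse mult.commute)
    qed
    then show "\<forall>\<^sub>F t in at 0. norm (f t - f 0 - t *\<^sub>R d) / norm t = norm ((f t - f 0) /\<^sub>R t - d)"
      by (auto simp: eventually_at_filter)
  qed
  then show ?thesis
    by (rule LIM_zero_cancel[OF tendsto_norm_zero_cancel])
qed

text \<open>By translation invariance the difference quotients of \<open>H\<close> have integral \<open>0\<close>. They converge to \<open>H'\<close>
  and, by the mean value inequality, are dominated by \<open>W\<close>.\<close>

lemma integral_deriv_along_eq_0:
  fixes H H' :: "real ^ 'd::finite \<Rightarrow> complex"
  assumes deriv: "\<And>x t. ((\<lambda>t. H (x + t *\<^sub>R axis i 1)) has_vector_derivative H' (x + t *\<^sub>R axis i 1)) (at t)"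
    and H: "integrable lborel H" and H': "H' \<in> borel_measurable borel"
    and W: "integrable lborel W" "\<And>x t. \<bar>t\<bar> \<le> 1 \<Longrightarrow> norm (H' (x + t *\<^sub>R axis i 1)) \<le> W x"
  shows "(LINT x|lborel. H' x) = 0"
proof -
  have Hm: "H \<in> borel_measurable borel" using borel_measurable_integrable[OF H] by simp
  define h :: "nat \<Rightarrow> real" where "h n = 1 / real (Suc n)" for n
  define D where "D n x = (H (x + h n *\<^sub>R axis i 1) - H x) /\<^sub>R h n" for n x
  have h: "0 < h n" "h n \<le> 1" for n by (auto simp: h_def)
  have "(\<lambda>n. LINT x|lborel. D n x) \<longlonglongrightarrow> (LINT x|lborel. H' x)"
  proof (rule integral_dominated_convergence[where w=W])
    show "AE x in lborel. (\<lambda>n. D n x) \<longlonglongrightarrow> H' x"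
    proof (rule AE_I2)
      fix x
      have "((\<lambda>t. (H (x + t *\<^sub>R axis i 1) - H x) /\<^sub>R t) \<longlongrightarrow> H' x) (at 0)"
        using has_vector_derivative_at_0_quotient[OF deriv[of x 0, unfolded scaleR_zero_left add_0_right]]
        by simp
      moreover have "filterlim h (at 0) sequentially"
        unfolding filterlim_at using h(1) LIMSEQ_inverse_real_of_nat
        by (auto simp: h_def[abs_def] inverse_eq_divide)
      ultimately show "(\<lambda>n. D n x) \<longlonglongrightarrow> H' x"
        unfolding D_def by (rule filterlim_compose)
    qed
    show "AE x in lborel. norm (D n x) \<le> W x" for n
    proof (rule AE_I2)
      fix x
      have "norm (H (x + h n *\<^sub>R axis i 1) - H (x + 0 *\<^sub>R axis i 1)) \<le> W x * norm (h n - 0)"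
      proof (rule differentiable_bound[where S="{0..h n}" and f'="\<lambda>t r. r *\<^sub>R H' (x + t *\<^sub>R axis i 1)"])
        fix t assume t: "t \<in> {0..h n}"
        show "((\<lambda>t. H (x + t *\<^sub>R axis i 1)) has_derivative (\<lambda>r. r *\<^sub>R H' (x + t *\<^sub>R axis i 1)))
            (at t within {0..h n})"
          using deriv[of x t] by (auto simp: has_vector_derivative_def intro: has_derivative_at_withinI)
        have "norm (H' (x + t *\<^sub>R axis i 1)) \<le> W x"
          using t h[of n] by (intro W) auto
        then show "onorm (\<lambda>r. r *\<^sub>R H' (x + t *\<^sub>R axis i 1)) \<le> W x"
          using order_trans[OF norm_ge_zero] by (intro onorm_bound) (auto simp: mult.commute mult_left_mono)
      qed (use h[of n] in auto)
      then show "norm (D n x) \<le> W x"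
        using h[of n] by (simp add: D_def divide_simps mult_ac)
    qed
  qed (use H' Hm W in \<open>auto simp: D_def[abs_def]\<close>)
  moreover have "(LINT x|lborel. D n x) = 0" for n
    using H Hm lborel_integrable_translate[OF H]
    by (simp add: D_def[abs_def] lborel_integral_translate)
  ultimately have "(\<lambda>n. 0) \<longlonglongrightarrow> (LINT x|lborel. H' x)" by simp
  then show ?thesis by (simp add: LIMSEQ_const_iff)
qed

text \<open>The additive character that occurs in the Fourier transform, in the inverse transform (at \<open>-r\<close>)
  and in the frequency shifts.\<close>

definition wave :: "real \<Rightarrow> complex" where
  "wave r = exp (- 2 * pi * \<i> * of_real r)"

lemma norm_wave [simp]: "norm (wave r) = 1"
  by (simp add: wave_def)

lemma wave_add: "wave (r + r') = wave r * wave r'"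
  by (simp add: wave_def exp_add[symmetric] algebra_simps)

lemma cnj_wave: "cnj (wave r) = wave (- r)"
  by (simp add: wave_def exp_cnj)

lemma wave_measurable [measurable]: "wave \<in> borel_measurable borel"
  unfolding wave_def[abs_def] by measurable

lemma fourier_eq: "fourier f \<xi> = (LINT x|lborel. f x * wave (x \<bullet> \<xi>))"
  by (simp add: fourier_def wave_def)

lemma wave_deriv_along:
  fixes x \<zeta> :: "real ^ 'd::finite"
  shows "((\<lambda>t. wave ((x + t *\<^sub>R axis i 1) \<bullet> \<zeta>)) has_vector_derivative
     - (2 * complex_of_real pi * \<i> * of_real (\<zeta> $ i)) * wave ((x + t *\<^sub>R axis i 1) \<bullet> \<zeta>)) (at t)"
proof -
  have "((\<lambda>t. - 2 * pi * \<i> * of_real ((x + t *\<^sub>R axis i 1) \<bullet> \<zeta>)) has_vector_derivative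
      - (2 * pi * \<i> * of_real (\<zeta> $ i))) (at t)"
    unfolding inner_add_left inner_scaleR_left inner_axis'
    by (auto intro!: derivative_eq_intros)
  from field_vector_diff_chain_at[OF this DERIV_exp] show ?thesis
    by (simp add: o_def wave_def)
qed

text \<open>A Gaussian of half the rate dominates all translates by at most one unit. This supplies the
  dominating function for integration by parts.\<close>

lemma gaussian_shift_le:
  fixes x a :: "real ^ 'd::finite"
  assumes "\<delta> > 0" "\<bar>t\<bar> \<le> 1"
  shows "exp (- \<delta> * (norm (x + t *\<^sub>R axis i 1 - a))\<^sup>2) \<le> exp \<delta> * exp (- (\<delta>/2) * (norm (x - a))\<^sup>2)"
proof -
  have "norm (x - a) \<le> norm (x + t *\<^sub>R axis i 1 - a) + norm (- (t *\<^sub>R axis i (1::real)) :: real ^ 'd)"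
    by (rule order_trans[OF _ norm_triangle_ineq]) simp
  also have "\<dots> \<le> norm (x + t *\<^sub>R axis i 1 - a) + 1"
    using assms by simp
  finally have "(norm (x - a))\<^sup>2 \<le> (norm (x + t *\<^sub>R axis i 1 - a) + 1)\<^sup>2"
    by (intro power_mono) auto
  also have "\<dots> \<le> 2 * (norm (x + t *\<^sub>R axis i 1 - a))\<^sup>2 + 2"
    using sum_squares_bound[of "norm (x + t *\<^sub>R axis i 1 - a)" 1] by (simp add: power2_sum)
  finally have "\<delta>/2 * (norm (x - a))\<^sup>2 \<le> \<delta>/2 * (2 * (norm (x + t *\<^sub>R axis i 1 - a))\<^sup>2 + 2)"
    using assms by (intro mult_left_mono) auto
  then show ?thesis by (simp add: exp_add[symmetric] algebra_simps)
qed

lemma integrable_gaussian_bound: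
  fixes f :: "real ^ 'd::finite \<Rightarrow> complex"
  assumes "f \<in> borel_measurable borel" "\<delta> > 0" "\<And>x. norm (f x) \<le> K * exp (- \<delta> * (norm (x - a))\<^sup>2)"
  shows "integrable lborel f"
proof (rule Bochner_Integration.integrable_bound)
  show "integrable lborel (\<lambda>x. K * exp (- \<delta> * (norm (x - a))\<^sup>2))"
    by (intro integrable_mult_right gaussian_integrable assms)
  show "AE x in lborel. norm (f x) \<le> norm (K * exp (- \<delta> * (norm (x - a))\<^sup>2))"
    using assms(3) by (auto intro!: order_trans[OF _ abs_ge_self])
qed (use assms in auto)

lemma integrable_fourier:
  assumes "integrable lborel f"
  shows "integrable lborel (\<lambda>x. f x * wave (x \<bullet> \<zeta>))"
proof (rule Bochner_Integration.integrable_bound[OF assms])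
  have [measurable]: "f \<in> borel_measurable borel" using borel_measurable_integrable[OF assms] by simp
  show "(\<lambda>x. f x * wave (x \<bullet> \<zeta>)) \<in> borel_measurable lborel"
    by measurable
qed (simp add: norm_mult)

lemma norm_fourier_le:
  "norm (fourier f \<zeta>) \<le> (LINT x|lborel. norm (f x))"
proof -
  have "norm (fourier f \<zeta>)
      \<le> (LINT x|lborel. norm (f x * wave (x \<bullet> \<zeta>)))"
    unfolding fourier_eq by (rule integral_norm_bound)
  then show ?thesis by (simp add: norm_mult)
qed

lemma fourier_deriv_along:
  fixes F :: "nat \<Rightarrow> real ^ 'd::finite \<Rightarrow> complex"
  assumes F: "derivs_along i F" and "\<delta> > 0"
    and bound: "\<And>x. norm (F n x) \<le> K * exp (- \<delta> * (norm (x - a))\<^sup>2)"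
      "\<And>x. norm (F (Suc n) x) \<le> K * exp (- \<delta> * (norm (x - a))\<^sup>2)"
  shows "fourier (F (Suc n)) \<zeta> = 2 * pi * \<i> * of_real (\<zeta> $ i) * fourier (F n) \<zeta>"
proof -
  let ?e = "\<lambda>x. wave (x \<bullet> \<zeta>)"
  let ?c = "2 * complex_of_real pi * \<i> * of_real (\<zeta> $ i)"
  have [measurable]: "F n \<in> borel_measurable borel" for n
    using F by (simp add: derivs_along_def)
  have K: "0 \<le> K"
    using order_trans[OF norm_ge_zero bound(1)[of a]] by simp
  have int: "integrable lborel (\<lambda>x. F n x * ?e x)" "integrable lborel (\<lambda>x. F (Suc n) x * ?e x)"
    using integrable_gaussian_bound[OF _ \<open>\<delta> > 0\<close> bound(1)]
      integrable_gaussian_bound[OF _ \<open>\<delta> > 0\<close> bound(2)]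
    by (auto intro!: integrable_fourier)
  have "(LINT x|lborel. F n x * (- ?c * ?e x) + F (Suc n) x * ?e x) = 0"
  proof (rule integral_deriv_along_eq_0[where H="\<lambda>x. F n x * ?e x" and i=i
        and W="\<lambda>x. (K * norm ?c + K) * (exp \<delta> * exp (- (\<delta>/2) * (norm (x - a))\<^sup>2))"])
    show "((\<lambda>t. F n (x + t *\<^sub>R axis i 1) * ?e (x + t *\<^sub>R axis i 1)) has_vector_derivative
        F n (x + t *\<^sub>R axis i 1) * (- ?c * ?e (x + t *\<^sub>R axis i 1))
          + F (Suc n) (x + t *\<^sub>R axis i 1) * ?e (x + t *\<^sub>R axis i 1)) (at t)" for x t
      by (intro has_vector_derivative_mult derivs_along_shifted[OF F] wave_deriv_along)
    show "norm (F n (x + t *\<^sub>R axis i 1) * (- ?c * ?e (x + t *\<^sub>R axis i 1))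
          + F (Suc n) (x + t *\<^sub>R axis i 1) * ?e (x + t *\<^sub>R axis i 1))
        \<le> (K * norm ?c + K) * (exp \<delta> * exp (- (\<delta>/2) * (norm (x - a))\<^sup>2))" if "\<bar>t\<bar> \<le> 1" for x t
    proof -
      let ?y = "x + t *\<^sub>R axis i 1"
      have "norm (F n ?y * (- ?c * ?e ?y) + F (Suc n) ?y * ?e ?y)
          \<le> norm (F n ?y) * norm ?c + norm (F (Suc n) ?y)"
        by (rule order_trans[OF norm_triangle_ineq]) (simp add: norm_mult)
      also have "\<dots> \<le> K * exp (- \<delta> * (norm (?y - a))\<^sup>2) * norm ?c + K * exp (- \<delta> * (norm (?y - a))\<^sup>2)"
        by (intro add_mono mult_right_mono bound) auto
      also have "\<dots> = (K * norm ?c + K) * exp (- \<delta> * (norm (?y - a))\<^sup>2)"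
        by (simp add: algebra_simps)
      also have "\<dots> \<le> (K * norm ?c + K) * (exp \<delta> * exp (- (\<delta>/2) * (norm (x - a))\<^sup>2))"
        using K that assms(2) by (intro mult_left_mono gaussian_shift_le) auto
      finally show ?thesis .
    qed
    show "integrable lborel (\<lambda>x. (K * norm ?c + K) * (exp \<delta> * exp (- (\<delta>/2) * (norm (x - a))\<^sup>2)))"
      using assms(2) by (intro integrable_mult_right gaussian_integrable) auto
  qed (use int in \<open>measurable\<close>)
  moreover have "(LINT x|lborel. F n x * (- ?c * ?e x) + F (Suc n) x * ?e x)
      = - ?c * (LINT x|lborel. F n x * ?e x) + (LINT x|lborel. F (Suc n) x * ?e x)"
    using int by (simp add: mult.left_commute[of "F n _"])
  ultimately show ?thesis unfolding fourier_eq
    by (simp add: add_eq_0_iff)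
qed

text \<open>Integration by parts along the axis of the largest coordinate \<open>\<zeta>\<^sub>i\<close> loses only a factor \<open>d\<close>, the
  dimension, as \<open>|\<zeta>| \<le> d |\<zeta>\<^sub>i|\<close>. The constants depend only on \<open>s\<close>, \<open>C\<close> and \<open>\<delta>\<close>, the bound is proportional to \<open>K\<close>, and
  the centre \<open>a\<close> is arbitrary. The proportionality is what allows the application to
  \<open>x\<^sub>i\<^sup>n g\<close> for all \<open>n\<close>, the free centre the uniformity in the frequency shift.\<close>

lemma fourier_decay:
  fixes s C \<delta> :: real
  assumes "s > 0" "C > 0" "\<delta> > 0"
  obtains A \<epsilon> where "A > 0" "\<epsilon> > 0"
    "\<And>h K a (\<zeta> :: real ^ 'd::finite). (\<And>i. gevrey_along i s C (\<lambda>x. K * exp (- \<delta> * (norm (x - a))\<^sup>2)) h)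
      \<Longrightarrow> norm (fourier h \<zeta>) \<le> K * A * exp (- \<epsilon> * norm \<zeta> powr (1/s))"
proof -
  define J where "J = (LINT x|lborel. exp (- \<delta> * (norm (x::real^'d))\<^sup>2))"
  have J: "0 \<le> J" unfolding J_def by (rule integral_nonneg_AE) simp
  define d where "d = real CARD('d)"
  have d: "d > 0" by (simp add: d_def)
  define \<epsilon>' where "\<epsilon>' = s / (2 * C powr (1/s))"
  define \<epsilon> where "\<epsilon> = \<epsilon>' * (1/d) powr (1/s)"
  have pos: "\<epsilon>' > 0" "\<epsilon> > 0" using assms d by (auto simp: \<epsilon>'_def \<epsilon>_def)
  have main: "norm (fourier h \<zeta>) \<le> K * (2 powr s * J + 1) * exp (- \<epsilon> * norm \<zeta> powr (1/s))"
    if gev: "\<And>i. gevrey_along i s C (\<lambda>x. K * exp (- \<delta> * (norm (x - a))\<^sup>2)) h"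
    for h :: "real ^ 'd \<Rightarrow> complex" and K and a \<zeta> :: "real ^ 'd"
  proof -
    have K: "0 \<le> K" using gevrey_along_weight_nonneg[OF gev, of a] by simp
    obtain i where i: "\<And>j. \<bar>\<zeta> $ j\<bar> \<le> \<bar>\<zeta> $ i\<bar>"
    proof -
      have "Max (range (\<lambda>j. \<bar>\<zeta> $ j\<bar>)) \<in> range (\<lambda>j. \<bar>\<zeta> $ j\<bar>)" by (intro Max_in) auto
      then obtain i where "Max (range (\<lambda>j. \<bar>\<zeta> $ j\<bar>)) = \<bar>\<zeta> $ i\<bar>" by (rule rangeE)
      then show thesis using that[of i] by (metis Max_ge finite_imageI rangeI finite)
    qed
    have "norm \<zeta> \<le> (\<Sum>j\<in>UNIV. \<bar>\<zeta> $ j\<bar>)" by (rule norm_le_l1_cart)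
    also have "\<dots> \<le> (\<Sum>j\<in>(UNIV::'d set). \<bar>\<zeta> $ i\<bar>)" by (intro sum_mono i)
    finally have "norm \<zeta> \<le> d * \<bar>\<zeta> $ i\<bar>" by (simp add: d_def)
    then have "1/d * norm \<zeta> \<le> \<bar>\<zeta> $ i\<bar>" using d by (simp add: field_simps)
    also have "\<dots> \<le> 2 * pi * \<bar>\<zeta> $ i\<bar>" using pi_gt3 by (simp add: mult_le_cancel_right1)
    finally have max: "1/d * norm \<zeta> \<le> 2 * pi * \<bar>\<zeta> $ i\<bar>" .
    obtain F where F: "F 0 = h" "derivs_along i F"
        "\<And>n x. norm (F n x) \<le> C ^ n * fact n powr s * (K * exp (- \<delta> * (norm (x - a))\<^sup>2))"
      using gev[of i] by (auto simp: gevrey_along_def)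
    have [measurable]: "F n \<in> borel_measurable borel" for n
      using F(2) by (simp add: derivs_along_def)
    have by_parts: "fourier (F n) \<zeta> = (2 * pi * \<i> * of_real (\<zeta> $ i)) ^ n * fourier h \<zeta>" for n
    proof (induction n)
      case (Suc n)
      \<comment> \<open>One constant for both \<open>F n\<close> and \<open>F (Suc n)\<close>, as integration by parts asks for.\<close>
      let ?M = "max (C ^ n * fact n powr s * K) (C ^ Suc n * fact (Suc n) powr s * K)"
      have "fourier (F (Suc n)) \<zeta> = 2 * pi * \<i> * of_real (\<zeta> $ i) * fourier (F n) \<zeta>"
      proof (rule fourier_deriv_along[OF F(2) \<open>\<delta> > 0\<close>, where K="?M" and a=a])
        show "norm (F n x) \<le> ?M * exp (- \<delta> * (norm (x - a))\<^sup>2)" for x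
          by (rule order_trans[OF F(3)[of n x]]) (simp add: mult.assoc[symmetric])
        show "norm (F (Suc n) x) \<le> ?M * exp (- \<delta> * (norm (x - a))\<^sup>2)" for x
          by (rule order_trans[OF F(3)[of "Suc n" x]]) (simp add: mult.assoc[symmetric])
      qed
      with Suc show ?case by simp
    qed (simp add: F)
    have "(2 * pi * \<bar>\<zeta> $ i\<bar>) ^ n * norm (fourier h \<zeta>) \<le> (K * J) * C ^ n * fact n powr s" for n
    proof -
      have "(2 * pi * \<bar>\<zeta> $ i\<bar>) ^ n * norm (fourier h \<zeta>) = norm (fourier (F n) \<zeta>)"
        by (simp add: by_parts norm_mult norm_power)
      also have "\<dots> \<le> (LINT x|lborel. norm (F n x))" by (rule norm_fourier_le)
      also have "\<dots> \<le> (LINT x|lborel. (C ^ n * fact n powr s * K) * exp (- \<delta> * (norm (x - a))\<^sup>2))"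
      proof (rule integral_mono)
        show "integrable lborel (\<lambda>x. norm (F n x))"
          by (rule integrable_norm, rule integrable_gaussian_bound[where K="C ^ n * fact n powr s * K", OF _ \<open>\<delta> > 0\<close>])
            (use F(3) in \<open>simp_all add: mult.assoc\<close>)
      qed (use F(3) in \<open>simp_all only: mult.assoc gaussian_integrable[OF \<open>\<delta> > 0\<close>] integrable_mult_right\<close>)
      also have "\<dots> = (C ^ n * fact n powr s * K) * J"
        using lborel_integral_translate[of "\<lambda>x. exp (- \<delta> * (norm (x::real^'d))\<^sup>2)" "- a"] by (simp add: J_def)
      finally show ?thesis by (simp add: mult_ac)
    qed
    then have "norm (fourier h \<zeta>) \<le> 2 powr s * (K * J) * exp (- \<epsilon>' * (2 * pi * \<bar>\<zeta> $ i\<bar>) powr (1/s))"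
      unfolding \<epsilon>'_def
      using assms K J by (intro factorial_growth_imp_stretched_exp) auto
    also have "\<dots> \<le> K * (2 powr s * J + 1) * exp (- \<epsilon> * norm \<zeta> powr (1/s))"
    proof (rule mult_mono)
      have "(1/d) powr (1/s) * norm \<zeta> powr (1/s) = (1/d * norm \<zeta>) powr (1/s)"
        using d by (subst powr_mult) auto
      also have "\<dots> \<le> (2 * pi * \<bar>\<zeta> $ i\<bar>) powr (1/s)"
        using max assms d by (intro powr_mono2) auto
      finally have "\<epsilon>' * ((1/d) powr (1/s) * norm \<zeta> powr (1/s)) \<le> \<epsilon>' * (2 * pi * \<bar>\<zeta> $ i\<bar>) powr (1/s)"
        using pos by (intro mult_left_mono) auto
      then show "exp (- \<epsilon>' * (2 * pi * \<bar>\<zeta> $ i\<bar>) powr (1/s)) \<le> exp (- \<epsilon> * norm \<zeta> powr (1/s))"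
        by (simp add: \<epsilon>_def mult.assoc)
      show "2 powr s * (K * J) \<le> K * (2 powr s * J + 1)"
        using K by (simp add: algebra_simps)
    qed (use K J in auto)
    finally show ?thesis .
  qed
  have "2 powr s * J + 1 > 0" using J by (intro add_nonneg_pos) auto
  with pos(2) show thesis using main that by blast
qed

section \<open>The Fourier transform preserves order 1/2 with Gaussian decay\<close>

text \<open>Differentiation under the integral sign, with the explicit remainder of the first-order Taylor
  expansion of the exponential: the error is at most \<open>t\<^sup>2\<close> times a multiple of the second moment of \<open>|h|\<close>.\<close>

lemma fourier_has_deriv_along:
  fixes h :: "real ^ 'd::finite \<Rightarrow> complex"
  assumes int: "\<And>k. integrable lborel (\<lambda>x. of_real (x $ i) ^ k * h x)"
  shows "((\<lambda>t. fourier h (\<zeta> + t *\<^sub>R axis i 1)) has_vector_derivative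
    fourier (\<lambda>x. - (2 * pi * \<i> * of_real (x $ i)) * h x) \<zeta>) (at 0)"
proof -
  define m where "m x = - (2 * complex_of_real pi * \<i> * of_real (x $ i))" for x :: "real ^ 'd"
  define M where "M = (LINT x|lborel. norm (h x) * ((2 * pi * (x $ i))\<^sup>2 / 2))"
  have h: "integrable lborel h" and mh: "integrable lborel (\<lambda>x. m x * h x)"
    using int[of 0] integrable_mult_right[OF int[of 1], of "- (2 * complex_of_real pi * \<i>)"]
    by (simp_all add: m_def mult.assoc)
  have sq: "integrable lborel (\<lambda>x. norm (h x) * ((2 * pi * (x $ i))\<^sup>2 / 2))"
    using integrable_mult_right[OF integrable_norm[OF int[of 2]], of "2 * pi\<^sup>2"]
    by (simp add: norm_mult norm_power power_mult_distrib mult_ac)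
  have "norm (fourier h (\<zeta> + t *\<^sub>R axis i 1) - fourier h \<zeta> - t *\<^sub>R fourier (\<lambda>x. m x * h x) \<zeta>) \<le> M * t\<^sup>2" for t
  proof -
    have split: "wave (x \<bullet> (\<zeta> + t *\<^sub>R axis i 1)) = wave (x \<bullet> \<zeta>) * wave (t * x $ i)" for x :: "real ^ 'd"
      by (simp add: inner_add_right inner_axis wave_add)
    have eq: "h x * wave (x \<bullet> (\<zeta> + t *\<^sub>R axis i 1)) - h x * wave (x \<bullet> \<zeta>) - t *\<^sub>R (m x * h x * wave (x \<bullet> \<zeta>))
        = h x * wave (x \<bullet> \<zeta>) * (wave (t * x $ i) - 1 - t *\<^sub>R m x)" for x
      unfolding split by (simp add: algebra_simps)
    have "fourier h (\<zeta> + t *\<^sub>R axis i 1) - fourier h \<zeta> - t *\<^sub>R fourier (\<lambda>x. m x * h x) \<zeta>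
        = (LINT x|lborel. h x * wave (x \<bullet> (\<zeta> + t *\<^sub>R axis i 1)) - h x * wave (x \<bullet> \<zeta>)
            - t *\<^sub>R (m x * h x * wave (x \<bullet> \<zeta>)))"
      using integrable_fourier[OF h] integrable_fourier[OF mh] by (simp add: fourier_eq)
    also have "\<dots> = (LINT x|lborel. h x * wave (x \<bullet> \<zeta>) * (wave (t * x $ i) - 1 - t *\<^sub>R m x))"
      unfolding eq ..
    also have "norm \<dots> \<le> (LINT x|lborel. norm (h x) * ((2 * pi * (x $ i))\<^sup>2 / 2) * t\<^sup>2)"
    proof (rule order_trans[OF integral_norm_bound integral_mono])
      have "integrable lborel (\<lambda>x. h x * wave (x \<bullet> (\<zeta> + t *\<^sub>R axis i 1)) - h x * wave (x \<bullet> \<zeta>)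
            - t *\<^sub>R (m x * h x * wave (x \<bullet> \<zeta>)))"
        using integrable_fourier[OF h] integrable_fourier[OF mh] by (intro Bochner_Integration.integrable_diff integrable_scaleR_right)
      then show "integrable lborel (\<lambda>x. norm (h x * wave (x \<bullet> \<zeta>) * (wave (t * x $ i) - 1 - t *\<^sub>R m x)))"
        unfolding eq by (rule integrable_norm)
      fix x :: "real ^ 'd"
      have "wave (t * x $ i) - 1 - t *\<^sub>R m x
          = iexp (- (2 * pi * (t * x $ i))) - (\<Sum>k\<le>1. (\<i> * of_real (- (2 * pi * (t * x $ i)))) ^ k / fact k)"
        by (simp add: wave_def m_def scaleR_conv_of_real algebra_simps)
      also have "norm \<dots> \<le> \<bar>- (2 * pi * (t * x $ i))\<bar> ^ Suc 1 / fact (Suc 1)"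
        by (rule iexp_approx1)
      also have "\<dots> = (2 * pi * (x $ i))\<^sup>2 / 2 * t\<^sup>2"
        by (simp add: power2_eq_square algebra_simps)
      finally show "norm (h x * wave (x \<bullet> \<zeta>) * (wave (t * x $ i) - 1 - t *\<^sub>R m x))
          \<le> norm (h x) * ((2 * pi * (x $ i))\<^sup>2 / 2) * t\<^sup>2"
        by (simp add: norm_mult mult.assoc mult_left_mono)
    qed (rule integrable_mult_left[OF sq])
    also have "\<dots> = M * t\<^sup>2" by (simp add: M_def)
    finally show ?thesis .
  qed
  then have le: "norm (fourier h (\<zeta> + t *\<^sub>R axis i 1) - fourier h \<zeta> - t *\<^sub>R fourier (\<lambda>x. m x * h x) \<zeta>) / \<bar>t\<bar>
      \<le> M * \<bar>t\<bar>" if "t \<noteq> 0" for t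
    using that by (simp add: divide_simps power2_eq_square abs_mult_self_eq mult.assoc)
  have "((\<lambda>t. fourier h (\<zeta> + t *\<^sub>R axis i 1)) has_derivative
      (\<lambda>t. t *\<^sub>R fourier (\<lambda>x. m x * h x) \<zeta>)) (at 0)"
  proof (rule has_derivativeI_sandwich[where e=1 and H="\<lambda>t. M * \<bar>t\<bar>"])
    have "((\<lambda>t. M * \<bar>t\<bar>) \<longlongrightarrow> M * \<bar>0\<bar>) (at 0)" by (intro tendsto_intros)
    then show "((\<lambda>t. M * \<bar>t\<bar>) \<longlongrightarrow> 0) (at 0)" by simp
  qed (use le in \<open>auto intro: bounded_linear_scaleR_left\<close>)
  then show ?thesis by (simp add: has_vector_derivative_def m_def)
qed

lemma fourier_measurable:
  assumes [measurable]: "h \<in> borel_measurable borel"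
  shows "fourier h \<in> borel_measurable borel"
proof -
  have "(\<lambda>\<xi>. LINT x|lborel. h x * wave (x \<bullet> \<xi>)) \<in> borel_measurable borel"
    by measurable
  then show ?thesis by (simp add: fourier_eq[abs_def])
qed

text \<open>The \<open>n\<close>-th derivative of the transform along the \<open>i\<close>-th axis is \<open>(-2\<pi>i)\<^sup>n\<close> times the transform of
  \<open>x\<^sub>i\<^sup>n g\<close>. Sacrificing half of the Gaussian of \<open>g\<close> to the monomial, \<open>x\<^sub>i\<^sup>n g\<close> is of order \<open>1/2\<close> in every
  direction with one constant \<open>1 + C\<close> for all \<open>n\<close>; only the weight \<open>K n\<close> depends on \<open>n\<close>, like
  \<open>(2c)\<^sup>n (n!)\<^bsup>1/2\<^esup>\<close>.\<close>

lemma fourier_gevrey_along: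
  fixes g :: "real ^ 'd::finite \<Rightarrow> complex"
  assumes "C > 0" "\<delta> > 0"
    and g: "\<And>j. gevrey_along j (1/2) C (\<lambda>x. C * exp (- \<delta> * (norm x)\<^sup>2)) g"
  obtains B D \<epsilon> where "B > 0" "D > 0" "\<epsilon> > 0"
    "\<And>i. gevrey_along i (1/2) B (\<lambda>\<zeta>. D * exp (- \<epsilon> * (norm \<zeta>)\<^sup>2)) (fourier g)"
proof -
  have [measurable]: "g \<in> borel_measurable borel"
    using g gevrey_along_measurable by blast
  \<comment> \<open>The base of the monomial bound for the rate \<open>\<delta>/2\<close>; it is at least \<open>1\<close> so that its powers increase.\<close>
  define c where "c = max 1 (1 / sqrt (2 * (\<delta>/2)))"
  define K where "K n = (2*c) ^ n * fact n powr (1/2) * C" for n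
  have c: "c \<ge> 1" "c \<ge> 1 / sqrt (2 * (\<delta>/2))" by (simp_all add: c_def)
  have monomial: "gevrey_along j (1/2) (1 + C) (\<lambda>x. K n * exp (- (\<delta>/2) * (norm (x - 0))\<^sup>2))
      (\<lambda>x. of_real ((x $ i) ^ n) * g x)" for i j n
  proof (rule gevrey_along_mono[OF gevrey_along_mult[OF gevrey_along_monomial[OF _ c] g]])
    fix x :: "real ^ 'd"
    have "exp (\<delta>/2 * (norm x)\<^sup>2) * exp (- \<delta> * (norm x)\<^sup>2) = exp (- (\<delta>/2) * (norm (x - 0))\<^sup>2)"
      by (simp add: exp_add[symmetric] algebra_simps)
    then show "(2*c) ^ n * fact n powr (1/2) * exp (\<delta>/2 * (norm x)\<^sup>2) * (C * exp (- \<delta> * (norm x)\<^sup>2))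
        \<le> K n * exp (- (\<delta>/2) * (norm (x - 0))\<^sup>2)"
      by (simp add: K_def mult_ac)
  qed (use assms in auto)
  obtain A \<epsilon> where A: "A > 0" "\<epsilon> > 0"
    "\<And>h K a (\<zeta> :: real ^ 'd). (\<And>i. gevrey_along i (1/2) (1 + C) (\<lambda>x. K * exp (- (\<delta>/2) * (norm (x - a))\<^sup>2)) h)
      \<Longrightarrow> norm (fourier h \<zeta>) \<le> K * A * exp (- \<epsilon> * norm \<zeta> powr (1 / (1/2)))"
    by (rule fourier_decay[of "1/2" "1 + C" "\<delta>/2"]) (use assms in auto)
  have decay: "norm (fourier (\<lambda>x. of_real ((x $ i) ^ n) * g x) \<zeta>) \<le> K n * A * exp (- \<epsilon> * (norm \<zeta>)\<^sup>2)" for i n \<zeta>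
    using A(3)[OF monomial, of i n \<zeta>] by simp
  have int: "integrable lborel (\<lambda>x. of_real (x $ i) ^ n * g x)" for i n
    using integrable_gaussian_bound[OF _ _ gevrey_along_bound[OF monomial[of _ n i]]] assms by simp
  have "gevrey_along i (1/2) (2 * pi * (2*c)) (\<lambda>\<zeta>. (C * A) * exp (- \<epsilon> * (norm \<zeta>)\<^sup>2)) (fourier g)" for i
  proof -
    define m where "m x = - (2 * complex_of_real pi * \<i> * of_real (x $ i))" for x :: "real ^ 'd"
    define G where "G n = fourier (\<lambda>x. m x ^ n * g x)" for n
    have m_power: "m x ^ n = (- (2 * complex_of_real pi * \<i>)) ^ n * of_real (x $ i) ^ n" for x n
      unfolding m_def by (simp flip: power_mult_distrib)
    have "((\<lambda>t. G n (\<zeta> + t *\<^sub>R axis i 1)) has_vector_derivative G (Suc n) \<zeta>) (at 0)" for n \<zeta>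
    proof -
      have eq: "of_real (x $ i) ^ k * (m x ^ n * g x)
          = (- (2 * complex_of_real pi * \<i>)) ^ n * (of_real (x $ i) ^ (k + n) * g x)" for x k
        unfolding m_power power_add by (simp only: mult_ac)
      have "integrable lborel (\<lambda>x. of_real (x $ i) ^ k * (m x ^ n * g x))" for k
        unfolding eq by (intro integrable_mult_right int)
      from fourier_has_deriv_along[OF this] show ?thesis
        unfolding G_def by (simp add: m_def mult.assoc)
    qed
    moreover have "G n \<in> borel_measurable borel" for n
      unfolding G_def m_def by (rule fourier_measurable) measurable
    ultimately have "derivs_along i G" by (simp add: derivs_along_def)
    moreover have "norm (G n \<zeta>) \<le> (2 * pi * (2*c)) ^ n * fact n powr (1/2) * ((C * A) * exp (- \<epsilon> * (norm \<zeta>)\<^sup>2))" for n \<zeta>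
    proof -
      have "G n \<zeta> = (- (2 * complex_of_real pi * \<i>)) ^ n * fourier (\<lambda>x. of_real ((x $ i) ^ n) * g x) \<zeta>"
        by (simp add: G_def m_power fourier_eq mult.assoc)
      then have "norm (G n \<zeta>) = (2 * pi) ^ n * norm (fourier (\<lambda>x. of_real ((x $ i) ^ n) * g x) \<zeta>)"
        by (simp add: norm_mult norm_power)
      also have "\<dots> \<le> (2 * pi) ^ n * (K n * A * exp (- \<epsilon> * (norm \<zeta>)\<^sup>2))"
        by (intro mult_left_mono decay) auto
      finally show ?thesis by (simp only: K_def power_mult_distrib mult_ac)
    qed
    moreover have "G 0 = fourier g" by (simp add: G_def)
    ultimately show ?thesis unfolding gevrey_along_def by blast
  qed
  then show thesis
    by (rule that[rotated -1]) (use A assms c pi_gt_zero in auto)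
qed

section \<open>Gabor matrix entries as Fourier integrals\<close>

lemma tf_shift_eq: "tf_shift (x, \<xi>) g t = wave (- (\<xi> \<bullet> t)) * g (t - x)"
  by (simp add: tf_shift_def wave_def)

lemma inv_fourier_eq: "inv_fourier h t = (LINT \<zeta>|lborel. h \<zeta> * wave (- (t \<bullet> \<zeta>)))"
  by (simp add: inv_fourier_def wave_def)


lemma fourier_tf_shift:
  fixes x \<xi> :: "real ^ 'd::finite"
  assumes [measurable]: "g \<in> borel_measurable borel"
  shows "fourier (tf_shift (x, \<xi>) g) \<zeta> = wave (x \<bullet> (\<zeta> - \<xi>)) * fourier g (\<zeta> - \<xi>)"
proof -
  have "fourier (tf_shift (x, \<xi>) g) \<zeta> = (LINT t|lborel. wave (- (\<xi> \<bullet> t)) * g (t - x) * wave (t \<bullet> \<zeta>))"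
    by (simp add: fourier_eq tf_shift_eq)
  also have "\<dots> = (LINT t|lborel. wave (- (\<xi> \<bullet> (t + x))) * g (t + x - x) * wave ((t + x) \<bullet> \<zeta>))"
    by (rule lborel_integral_translate[symmetric]) measurable
  also have "\<dots> = (LINT t|lborel. wave (x \<bullet> (\<zeta> - \<xi>)) * (g t * wave (t \<bullet> (\<zeta> - \<xi>))))"
  proof (intro Bochner_Integration.integral_cong refl)
    fix t
    have "- (\<xi> \<bullet> (t + x)) + (t + x) \<bullet> \<zeta> = x \<bullet> (\<zeta> - \<xi>) + t \<bullet> (\<zeta> - \<xi>)"
      by (simp add: inner_add_left inner_add_right inner_diff_right inner_commute)
    then have "wave (- (\<xi> \<bullet> (t + x))) * wave ((t + x) \<bullet> \<zeta>) = wave (x \<bullet> (\<zeta> - \<xi>)) * wave (t \<bullet> (\<zeta> - \<xi>))"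
      by (simp only: wave_add[symmetric])
    then show "wave (- (\<xi> \<bullet> (t + x))) * g (t + x - x) * wave ((t + x) \<bullet> \<zeta>)
        = wave (x \<bullet> (\<zeta> - \<xi>)) * (g t * wave (t \<bullet> (\<zeta> - \<xi>)))"
      by (simp add: mult_ac)
  qed
  finally show ?thesis by (simp add: fourier_eq)
qed

text \<open>One of the two functions is given as an inverse transform, so this instance of Parseval's formula is
  an exchange of the two integrations.\<close>

lemma L2_inner_inv_fourier:
  fixes f h :: "real ^ 'd::finite \<Rightarrow> complex"
  assumes f: "integrable lborel f" and h: "integrable lborel h"
  shows "L2_inner (inv_fourier h) f = (LINT \<zeta>|lborel. h \<zeta> * cnj (fourier f \<zeta>))"
proof -
  have [measurable]: "f \<in> borel_measurable borel" "h \<in> borel_measurable borel"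
    using f h borel_measurable_integrable by auto
  have [measurable]: "cnj \<in> borel_measurable borel"
    by (intro borel_measurable_continuous_onI continuous_intros)
  let ?k = "\<lambda>\<zeta> t. h \<zeta> * (cnj (f t) * wave (- (t \<bullet> \<zeta>)))"
  have kint: "integrable lborel (\<lambda>t. ?k \<zeta> t)" for \<zeta>
  proof (rule Bochner_Integration.integrable_bound)
    show "integrable lborel (\<lambda>t. norm (h \<zeta>) * norm (f t))" using f by simp
    show "(\<lambda>t. ?k \<zeta> t) \<in> borel_measurable lborel" by measurable
  qed (simp add: norm_mult)
  have joint: "integrable (lborel \<Otimes>\<^sub>M lborel) (case_prod ?k)"
  proof (rule lborel_pair.Fubini_integrable)
    have "(\<lambda>z. ?k (fst z) (snd z)) \<in> borel_measurable (borel \<Otimes>\<^sub>M borel)" by measurable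
    then show "case_prod ?k \<in> borel_measurable (lborel \<Otimes>\<^sub>M lborel)"
      by (simp add: case_prod_beta' cong: measurable_cong_sets)
    show "integrable lborel (\<lambda>\<zeta>. LINT t|lborel. norm (case_prod ?k (\<zeta>, t)))"
      using h by (simp add: norm_mult)
    show "AE \<zeta> in lborel. integrable lborel (\<lambda>t. case_prod ?k (\<zeta>, t))"
      using kint by simp
  qed
  have "L2_inner (inv_fourier h) f = (LINT t|lborel. (LINT \<zeta>|lborel. ?k \<zeta> t))"
  proof -
    have "inv_fourier h t * cnj (f t) = (LINT \<zeta>|lborel. ?k \<zeta> t)" for t
      unfolding inv_fourier_eq
      by (subst integral_mult_left_zero[symmetric]) (simp add: mult_ac)
    then show ?thesis by (simp add: L2_inner_def)
  qed
  also have "\<dots> = (LINT \<zeta>|lborel. (LINT t|lborel. ?k \<zeta> t))"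
    by (rule lborel_pair.Fubini_integral[OF joint])
  also have "\<dots> = (LINT \<zeta>|lborel. h \<zeta> * cnj (fourier f \<zeta>))"
  proof -
    have "cnj (fourier f \<zeta>) = (LINT t|lborel. cnj (f t) * wave (- (t \<bullet> \<zeta>)))" for \<zeta>
      by (simp add: fourier_eq cnj_wave Bochner_Integration.integral_cnj[symmetric] del: Bochner_Integration.integral_cnj)
    then show ?thesis by simp
  qed
  finally show ?thesis .
qed

text \<open>The Fourier transform turns the shifts by \<open>x\<close> and \<open>y\<close> into modulations, which combine to the character
  at \<open>x - y\<close>, and the modulations into shifts of \<open>\<gamma>\<close>. The constant phase \<open>y \<cdot> \<eta> - x \<cdot> \<xi>\<close> disappears in
  the norm.\<close>

lemma norm_L2_inner_multiplier:
  fixes \<sigma> g :: "real ^ 'd::finite \<Rightarrow> complex"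
  assumes \<sigma>: "\<sigma> \<in> borel_measurable borel" "\<And>\<zeta>. norm (\<sigma> \<zeta>) \<le> M"
    and g: "integrable lborel g" and fg: "integrable lborel (fourier g)"
  shows "norm (L2_inner (fourier_multiplier \<sigma> (tf_shift (x, \<xi>) g)) (tf_shift (y, \<eta>) g))
    = norm (fourier (\<lambda>\<zeta>. \<sigma> \<zeta> * (fourier g (\<zeta> - \<xi>) * cnj (fourier g (\<zeta> - \<eta>)))) (x - y))"
proof -
  have gm [measurable]: "g \<in> borel_measurable borel" "\<sigma> \<in> borel_measurable borel"
      "fourier g \<in> borel_measurable borel"
    using g \<sigma> fg borel_measurable_integrable by auto
  have shifted: "integrable lborel (tf_shift (y, \<eta>) g)"
  proof (rule Bochner_Integration.integrable_bound)
    show "integrable lborel (\<lambda>t. g (t + - y))" by (rule lborel_integrable_translate[OF g])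
    show "tf_shift (y, \<eta>) g \<in> borel_measurable lborel"
      unfolding tf_shift_eq by measurable
  qed (simp add: tf_shift_eq norm_mult)
  have prod: "integrable lborel (\<lambda>\<zeta>. \<sigma> \<zeta> * (wave (x \<bullet> (\<zeta> - \<xi>)) * fourier g (\<zeta> - \<xi>)))"
  proof (rule Bochner_Integration.integrable_bound)
    show "integrable lborel (\<lambda>\<zeta>. M * norm (fourier g (\<zeta> + - \<xi>)))"
      using lborel_integrable_translate[OF fg, of "- \<xi>"] by simp
    show "AE \<zeta> in lborel. norm (\<sigma> \<zeta> * (wave (x \<bullet> (\<zeta> - \<xi>)) * fourier g (\<zeta> - \<xi>)))
        \<le> norm (M * norm (fourier g (\<zeta> + - \<xi>)))"
      using \<sigma>(2) by (auto simp: norm_mult intro!: mult_right_mono order_trans[OF _ abs_ge_self])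
  qed (measurable)
  have "L2_inner (fourier_multiplier \<sigma> (tf_shift (x, \<xi>) g)) (tf_shift (y, \<eta>) g)
      = (LINT \<zeta>|lborel. \<sigma> \<zeta> * (wave (x \<bullet> (\<zeta> - \<xi>)) * fourier g (\<zeta> - \<xi>))
          * cnj (wave (y \<bullet> (\<zeta> - \<eta>)) * fourier g (\<zeta> - \<eta>)))"
    using L2_inner_inv_fourier[OF shifted prod]
    by (simp add: fourier_multiplier_def fourier_tf_shift[OF gm(1)])
  also have "\<dots> = (LINT \<zeta>|lborel. wave (y \<bullet> \<eta> - x \<bullet> \<xi>) *
      (\<sigma> \<zeta> * (fourier g (\<zeta> - \<xi>) * cnj (fourier g (\<zeta> - \<eta>))) * wave (\<zeta> \<bullet> (x - y))))"
  proof (intro Bochner_Integration.integral_cong refl)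
    fix \<zeta>
    have "x \<bullet> (\<zeta> - \<xi>) + - (y \<bullet> (\<zeta> - \<eta>)) = (y \<bullet> \<eta> - x \<bullet> \<xi>) + \<zeta> \<bullet> (x - y)"
      by (simp add: inner_diff_right inner_commute)
    then have "wave (x \<bullet> (\<zeta> - \<xi>)) * wave (- (y \<bullet> (\<zeta> - \<eta>))) = wave (y \<bullet> \<eta> - x \<bullet> \<xi>) * wave (\<zeta> \<bullet> (x - y))"
      by (simp only: wave_add[symmetric])
    then show "\<sigma> \<zeta> * (wave (x \<bullet> (\<zeta> - \<xi>)) * fourier g (\<zeta> - \<xi>))
          * cnj (wave (y \<bullet> (\<zeta> - \<eta>)) * fourier g (\<zeta> - \<eta>)) = wave (y \<bullet> \<eta> - x \<bullet> \<xi>) *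
      (\<sigma> \<zeta> * (fourier g (\<zeta> - \<xi>) * cnj (fourier g (\<zeta> - \<eta>))) * wave (\<zeta> \<bullet> (x - y)))"
      by (simp add: cnj_wave mult_ac)
  qed
  finally show ?thesis by (simp add: fourier_eq norm_mult)
qed

section \<open>Decay in the frequencies\<close>

lemma powr_add_le:
  fixes a b p :: real
  assumes "a \<ge> 0" "b \<ge> 0" "0 \<le> p" "p \<le> 2"
  shows "(a + b) powr p \<le> 4 * (a powr p + b powr p)"
proof -
  have "(a + b) powr p \<le> (2 * max a b) powr p"
    using assms by (intro powr_mono2) auto
  also have "\<dots> = 2 powr p * max a b powr p" by (rule powr_mult)
  also have "\<dots> \<le> 4 * (a powr p + b powr p)"
  proof (intro mult_mono)
    have "(2::real) powr p \<le> 2 powr 2" using assms by (intro powr_mono) auto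
    then show "(2::real) powr p \<le> 4" by simp
    show "max a b powr p \<le> a powr p + b powr p" by (auto simp: max_def)
  qed auto
  finally show ?thesis .
qed

lemma powr_le_one_plus_powr:
  fixes t p q :: real
  assumes "t \<ge> 0" "0 \<le> p" "p \<le> q"
  shows "t powr p \<le> 1 + t powr q"
proof (cases "t \<le> 1")
  case True
  then have "t powr p \<le> 1 powr p" using assms by (intro powr_mono2) auto
  then show ?thesis by (simp add: add_increasing2)
next
  case False
  then have "t powr p \<le> t powr q" using assms by (intro powr_mono) auto
  then show ?thesis by simp
qed

lemma powr_le_one_plus_square:
  fixes t p :: real
  assumes "t \<ge> 0" "0 \<le> p" "p \<le> 2"
  shows "t powr p \<le> 1 + t\<^sup>2"
  using powr_le_one_plus_powr[of t p 2] assms by simp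

lemma interpolate_exp_bounds:
  fixes X K L a b :: real
  assumes "X \<le> K * exp (- a)" "X \<le> L * exp (- b)" "K \<ge> 0" "L \<ge> 0"
  shows "X \<le> (K + L) * exp (- ((a + b) / 2))"
proof (cases "a \<le> b")
  case True
  note assms(2)
  also have "L * exp (- b) \<le> (K + L) * exp (- ((a + b) / 2))"
    using assms True by (intro mult_mono) auto
  finally show ?thesis .
next
  case False
  note assms(1)
  also have "K * exp (- a) \<le> (K + L) * exp (- ((a + b) / 2))"
    using assms False by (intro mult_mono) auto
  finally show ?thesis .
qed

lemma decay_weight_bounds:
  assumes "\<epsilon> > 0"
  shows "0 \<le> decay_weight \<epsilon> \<nu> \<xi>" "decay_weight \<epsilon> \<nu> \<xi> \<le> 1"
  using assms by (auto simp: decay_weight_def)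

text \<open>Of \<open>\<zeta> - \<xi>\<close> and \<open>\<zeta> - \<eta>\<close>, one has at least half the length of \<open>\<xi> - \<eta>\<close>. Replacing the exponent \<open>2\<close> by \<open>p\<close>
  costs the additive constants collected in \<open>exp \<epsilon>\<close>.\<close>

lemma frequency_difference_decay:
  fixes \<xi> \<eta> \<zeta> :: "real ^ 'd::finite"
  assumes "\<epsilon> > 0" "0 \<le> p" "p \<le> 2"
  shows "exp (- (\<epsilon>/2) * (norm (\<zeta> - \<xi>))\<^sup>2) * exp (- (\<epsilon>/2) * (norm (\<zeta> - \<eta>))\<^sup>2)
    \<le> exp \<epsilon> * exp (- (\<epsilon>/8) * norm (\<xi> - \<eta>) powr p)"
proof -
  let ?a = "norm (\<zeta> - \<xi>)" and ?b = "norm (\<zeta> - \<eta>)"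
  have "norm (\<xi> - \<eta>) \<le> ?a + ?b"
    using norm_triangle_ineq4[of "\<zeta> - \<eta>" "\<zeta> - \<xi>"] by simp
  then have "norm (\<xi> - \<eta>) powr p \<le> (?a + ?b) powr p"
    using assms by (intro powr_mono2) auto
  also have "\<dots> \<le> 4 * (?a powr p + ?b powr p)" using assms by (intro powr_add_le) auto
  also have "\<dots> \<le> 4 * ((1 + ?a\<^sup>2) + (1 + ?b\<^sup>2))"
    using assms by (intro mult_left_mono add_mono powr_le_one_plus_square) auto
  finally have "(\<epsilon>/8) * norm (\<xi> - \<eta>) powr p \<le> (\<epsilon>/8) * (4 * ((1 + ?a\<^sup>2) + (1 + ?b\<^sup>2)))"
    using assms by (intro mult_left_mono) auto
  then show ?thesis by (simp add: exp_add[symmetric] algebra_simps)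
qed

text \<open>Each of \<open>|\<xi>|\<^sup>p\<close> and \<open>|\<eta>|\<^sup>p\<close> is controlled by \<open>|\<zeta>|\<^sup>p\<close> and the distance to \<open>\<zeta>\<close>; the exponent \<open>p\<close> may then
  be raised to \<open>q\<close> or to \<open>2\<close> up to an additive constant, which is the origin of \<open>exp (4 \<kappa>)\<close>. The
  coefficient \<open>2\<close> of \<open>|\<zeta>|\<^sup>q\<close> comes from using \<open>\<zeta>\<close> twice and explains the condition \<open>2 \<kappa> \<le> \<epsilon>'\<close>.\<close>

lemma frequency_decay:
  fixes \<xi> \<eta> \<zeta> :: "real ^ 'd::finite"
  assumes \<kappa>: "0 < \<kappa>" "\<kappa> \<le> \<epsilon>/2" "2 * \<kappa> \<le> \<epsilon>'" and p: "0 \<le> p" "p \<le> q" "q \<le> 2"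
  shows "exp (- \<epsilon>' * norm \<zeta> powr q) *
      (exp (- (\<epsilon>/2) * (norm (\<zeta> - \<xi>))\<^sup>2) * exp (- (\<epsilon>/2) * (norm (\<zeta> - \<eta>))\<^sup>2))
    \<le> exp (4*\<kappa>) * exp (- (\<kappa>/16) * ((norm \<xi>)\<^sup>2 + (norm \<eta>)\<^sup>2) powr (p/2))"
proof -
  let ?n = "norm \<zeta>" and ?a = "norm (\<zeta> - \<xi>)" and ?b = "norm (\<zeta> - \<eta>)"
  have near: "norm \<theta> powr p \<le> 4 * ((1 + ?n powr q) + (1 + (norm (\<zeta> - \<theta>))\<^sup>2))" for \<theta>
  proof -
    have "norm \<theta> powr p \<le> (?n + norm (\<zeta> - \<theta>)) powr p"
      using norm_triangle_ineq4[of \<zeta> "\<zeta> - \<theta>"] p by (intro powr_mono2) auto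
    also have "\<dots> \<le> 4 * (?n powr p + norm (\<zeta> - \<theta>) powr p)" using p by (intro powr_add_le) auto
    also have "\<dots> \<le> 4 * ((1 + ?n powr q) + (1 + (norm (\<zeta> - \<theta>))\<^sup>2))"
      using p by (intro mult_left_mono add_mono powr_le_one_plus_powr powr_le_one_plus_square) auto
    finally show ?thesis .
  qed
  have "((norm \<xi>)\<^sup>2 + (norm \<eta>)\<^sup>2) powr (p/2) \<le> ((norm \<xi> + norm \<eta>)\<^sup>2) powr (p/2)"
    using p by (intro powr_mono2) (auto simp: power2_sum)
  also have "\<dots> = (norm \<xi> + norm \<eta>) powr p"
  proof -
    have "(norm \<xi> + norm \<eta>)\<^sup>2 = (norm \<xi> + norm \<eta>) powr 2" by simp
    then show ?thesis by (simp only: powr_powr) simp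
  qed
  also have "\<dots> \<le> 4 * (norm \<xi> powr p + norm \<eta> powr p)" using p by (intro powr_add_le) auto
  also have "\<dots> \<le> 16 * (4 + 2 * ?n powr q + ?a\<^sup>2 + ?b\<^sup>2)"
    using near[of \<xi>] near[of \<eta>] by simp
  finally have "(\<kappa>/16) * ((norm \<xi>)\<^sup>2 + (norm \<eta>)\<^sup>2) powr (p/2)
      \<le> (\<kappa>/16) * (16 * (4 + 2 * ?n powr q + ?a\<^sup>2 + ?b\<^sup>2))"
    using \<kappa> by (intro mult_left_mono) auto
  also have "\<dots> = 4 * \<kappa> + (2 * \<kappa>) * ?n powr q + \<kappa> * ?a\<^sup>2 + \<kappa> * ?b\<^sup>2"
    by (simp add: algebra_simps)
  also have "\<dots> \<le> 4 * \<kappa> + \<epsilon>' * ?n powr q + (\<epsilon>/2) * ?a\<^sup>2 + (\<epsilon>/2) * ?b\<^sup>2"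
    using \<kappa> by (intro add_mono mult_right_mono) auto
  finally show ?thesis by (simp add: exp_add[symmetric] algebra_simps)
qed

section \<open>The two estimates and their combination\<close>

lemma norm_fourier_gaussian_le:
  fixes h :: "real ^ 'd::finite \<Rightarrow> complex"
  assumes "h \<in> borel_measurable borel" "\<delta> > 0"
    and le: "\<And>x. norm (h x) \<le> K * exp (- \<delta> * (norm (x - a))\<^sup>2)"
  shows "norm (fourier h \<zeta>) \<le> K * (LINT x|lborel. exp (- \<delta> * (norm (x :: real ^ 'd))\<^sup>2))"
proof -
  have "norm (fourier h \<zeta>) \<le> (LINT x|lborel. norm (h x))" by (rule norm_fourier_le)
  also have "\<dots> \<le> (LINT x|lborel. K * exp (- \<delta> * (norm (x - a))\<^sup>2))"
    by (intro integral_mono integrable_norm integrable_mult_right gaussian_integrable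
        integrable_gaussian_bound[OF assms] assms)
  also have "\<dots> = K * (LINT x|lborel. exp (- \<delta> * (norm (x :: real ^ 'd))\<^sup>2))"
    using lborel_integral_translate[of "\<lambda>x. exp (- \<delta> * (norm (x::real^'d))\<^sup>2)" "- a"] by simp
  finally show ?thesis .
qed

text \<open>The two estimates for a matrix entry. The bound in \<open>x - y\<close> discards the decay of \<open>\<sigma>\<close> and of the factor
  centred at \<open>\<eta>\<close>, keeping one Gaussian for integrability. The frequency bound splits each Gaussian in
  halves: one half of the one centred at \<open>\<xi>\<close> makes the integral converge, and the halves in the premise
  are left to produce a pointwise bound \<open>Q\<close>, which is the only place where finite and infinite
  \<open>\<nu>\<close> differ.\<close>

lemma gabor_matrix_two_bounds:
  fixes \<sigma> g :: "real ^ 'd::finite \<Rightarrow> complex"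
  assumes \<mu>: "1/2 \<le> \<mu>"
    and \<sigma>: "\<sigma> \<in> gelfand_shilov \<mu> \<nu>"
    and g: "g \<in> gelfand_shilov (1/2) (ereal (1/2))"
  obtains K L \<alpha> \<beta> \<epsilon> where "K > 0" "L > 0" "\<alpha> > 0" "\<beta> > 0" "\<epsilon> > 0"
    "\<And>x \<xi> y \<eta>. norm (L2_inner (fourier_multiplier \<sigma> (tf_shift (x, \<xi>) g)) (tf_shift (y, \<eta>) g))
        \<le> K * exp (- \<alpha> * norm (x - y) powr (1/\<mu>))"
    "\<And>x \<xi> y \<eta> Q. (\<And>\<zeta>. decay_weight \<beta> \<nu> \<zeta> *
          (exp (- (\<epsilon>/2) * (norm (\<zeta> - \<xi>))\<^sup>2) * exp (- (\<epsilon>/2) * (norm (\<zeta> - \<eta>))\<^sup>2)) \<le> Q)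
      \<Longrightarrow> norm (L2_inner (fourier_multiplier \<sigma> (tf_shift (x, \<xi>) g)) (tf_shift (y, \<eta>) g)) \<le> L * Q"
proof -
  obtain S \<beta> where S: "S > 0" "\<beta> > 0"
    and \<sigma>_gev: "\<And>i. gevrey_along i \<mu> S (\<lambda>x. S * decay_weight \<beta> \<nu> x) \<sigma>"
    using gelfand_shilov_gevrey_along[OF \<sigma>] by metis
  obtain C \<delta> where C: "C > 0" "\<delta> > 0"
    and "\<And>i. gevrey_along i (1/2) C (\<lambda>x. C * decay_weight \<delta> (ereal (1/2)) x) g"
    using gelfand_shilov_gevrey_along[OF g] by metis
  then have g_gev: "\<And>i. gevrey_along i (1/2) C (\<lambda>x. C * exp (- \<delta> * (norm x)\<^sup>2)) g"
    by (simp add: decay_weight_def)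
  obtain B D \<epsilon> where B: "B > 0" "D > 0" "\<epsilon> > 0"
    and \<gamma>_gev: "\<And>i. gevrey_along i (1/2) B (\<lambda>\<zeta>. D * exp (- \<epsilon> * (norm \<zeta>)\<^sup>2)) (fourier g)"
    using fourier_gevrey_along[OF C g_gev] by metis
  have [measurable]: "\<sigma> \<in> borel_measurable borel" "fourier g \<in> borel_measurable borel"
      "g \<in> borel_measurable borel"
    using \<sigma>_gev \<gamma>_gev g_gev gevrey_along_measurable by blast+
  have [measurable]: "cnj \<in> borel_measurable borel"
    by (intro borel_measurable_continuous_onI continuous_intros)
  have \<sigma>_le: "norm (\<sigma> \<zeta>) \<le> S * decay_weight \<beta> \<nu> \<zeta>" for \<zeta>
    using gevrey_along_bound[OF \<sigma>_gev] .
  have \<gamma>_le: "norm (fourier g \<zeta>) \<le> D * exp (- \<epsilon> * (norm \<zeta>)\<^sup>2)" for \<zeta>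
    using gevrey_along_bound[OF \<gamma>_gev] .
  define \<Phi> where "\<Phi> \<xi> \<eta> \<zeta> = \<sigma> \<zeta> * (fourier g (\<zeta> - \<xi>) * cnj (fourier g (\<zeta> - \<eta>)))" for \<xi> \<eta> \<zeta>
  have entry: "norm (L2_inner (fourier_multiplier \<sigma> (tf_shift (x, \<xi>) g)) (tf_shift (y, \<eta>) g))
      = norm (fourier (\<Phi> \<xi> \<eta>) (x - y))" for x \<xi> y \<eta>
    unfolding \<Phi>_def
  proof (rule norm_L2_inner_multiplier)
    show "norm (\<sigma> \<zeta>) \<le> S" for \<zeta>
      using \<sigma>_le[of \<zeta>] decay_weight_bounds(2)[OF S(2), of \<nu> \<zeta>] S(1)
      by (meson less_imp_le mult_left_le order_trans)
    show "integrable lborel g"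
      by (rule integrable_gaussian_bound[OF _ C(2), where a=0 and K=C])
        (use gevrey_along_bound[OF g_gev] in auto)
    show "integrable lborel (fourier g)"
      by (rule integrable_gaussian_bound[OF _ B(3), where a=0 and K=D]) (use \<gamma>_le in auto)
  qed simp
  have \<Phi>_gev: "gevrey_along i \<mu> (S + (B + B)) (\<lambda>\<zeta>. (S * D * D) * exp (- \<epsilon> * (norm (\<zeta> - \<xi>))\<^sup>2)) (\<Phi> \<xi> \<eta>)" for i \<xi> \<eta>
  proof -
    have left: "gevrey_along i \<mu> B (\<lambda>\<zeta>. D * exp (- \<epsilon> * (norm (\<zeta> - \<xi>))\<^sup>2)) (\<lambda>\<zeta>. fourier g (\<zeta> - \<xi>))"
      by (rule gevrey_along_mono[OF gevrey_along_translate[OF \<gamma>_gev] \<mu>]) (use B in auto)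
    have right: "gevrey_along i \<mu> B (\<lambda>\<zeta>. D) (\<lambda>\<zeta>. cnj (fourier g (\<zeta> - \<eta>)))"
      by (rule gevrey_along_mono[OF gevrey_along_cnj[OF gevrey_along_translate[OF \<gamma>_gev]] \<mu>])
        (use B in auto)
    show ?thesis unfolding \<Phi>_def
    proof (rule gevrey_along_mono[OF gevrey_along_mult[OF \<sigma>_gev gevrey_along_mult[OF left right]]])
      show "S * decay_weight \<beta> \<nu> \<zeta> * (D * exp (- \<epsilon> * (norm (\<zeta> - \<xi>))\<^sup>2) * D)
          \<le> (S * D * D) * exp (- \<epsilon> * (norm (\<zeta> - \<xi>))\<^sup>2)" for \<zeta>
        using mult_right_mono[OF decay_weight_bounds(2)[OF S(2), of \<nu> \<zeta>],
            of "(S * D * D) * exp (- \<epsilon> * (norm (\<zeta> - \<xi>))\<^sup>2)"] S B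
        by (simp add: mult_ac)
    qed (use S B \<mu> in auto)
  qed
  obtain A \<alpha> where A: "A > 0" "\<alpha> > 0"
    "\<And>h K a (\<zeta> :: real ^ 'd). (\<And>i. gevrey_along i \<mu> (S + (B + B)) (\<lambda>x. K * exp (- \<epsilon> * (norm (x - a))\<^sup>2)) h)
      \<Longrightarrow> norm (fourier h \<zeta>) \<le> K * A * exp (- \<alpha> * norm \<zeta> powr (1/\<mu>))"
    by (rule fourier_decay[of \<mu> "S + (B + B)" \<epsilon>]) (use S B \<mu> in auto)
  define J where "J = (LINT x|lborel. exp (- (\<epsilon>/2) * (norm (x :: real ^ 'd))\<^sup>2))"
  have J: "J \<ge> 0" unfolding J_def by (rule integral_nonneg_AE) simp
  have frequency: "norm (fourier (\<Phi> \<xi> \<eta>) u) \<le> (S * D * D * J + 1) * Q"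
    if Q: "\<And>\<zeta>. decay_weight \<beta> \<nu> \<zeta> *
          (exp (- (\<epsilon>/2) * (norm (\<zeta> - \<xi>))\<^sup>2) * exp (- (\<epsilon>/2) * (norm (\<zeta> - \<eta>))\<^sup>2)) \<le> Q" for \<xi> \<eta> u Q
  proof -
    have "0 \<le> Q"
      using decay_weight_bounds(1)[OF S(2), of \<nu> \<xi>] by (intro order_trans[OF _ Q[of \<xi>]]) auto
    have "norm (fourier (\<Phi> \<xi> \<eta>) u) \<le> (S * D * D * Q) * J" unfolding J_def
    proof (rule norm_fourier_gaussian_le)
      show "\<Phi> \<xi> \<eta> \<in> borel_measurable borel" unfolding \<Phi>_def by measurable
      fix \<zeta>
      let ?a = "exp (- (\<epsilon>/2) * (norm (\<zeta> - \<xi>))\<^sup>2)" and ?b = "exp (- (\<epsilon>/2) * (norm (\<zeta> - \<eta>))\<^sup>2)"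
      have half: "exp (- \<epsilon> * r) = exp (- (\<epsilon>/2) * r) * exp (- (\<epsilon>/2) * r)" for r
        by (simp add: exp_add[symmetric])
      have "?b \<le> 1" using B by simp
      \<comment> \<open>Both Gaussians are written as squares of their halves; one \<open>?a\<close> is kept for integrability, one \<open>?b\<close>
        is dropped.\<close>
      have "norm (\<Phi> \<xi> \<eta> \<zeta>) \<le> (S * decay_weight \<beta> \<nu> \<zeta>) * ((D * (?a * ?a)) * (D * (?b * ?b)))"
        unfolding \<Phi>_def norm_mult complex_mod_cnj half[symmetric]
        using decay_weight_bounds(1)[OF S(2), of \<nu> \<zeta>] S B
        by (intro mult_mono \<sigma>_le \<gamma>_le) auto
      also have "\<dots> = (S * D * D) * (decay_weight \<beta> \<nu> \<zeta> * (?a * ?b)) * (?a * ?b)"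
        by (simp only: mult_ac)
      also have "\<dots> \<le> (S * D * D) * Q * (?a * 1)"
        using S B \<open>0 \<le> Q\<close> \<open>?b \<le> 1\<close> by (intro mult_mono mult_left_mono Q) auto
      finally show "norm (\<Phi> \<xi> \<eta> \<zeta>) \<le> (S * D * D * Q) * ?a" by simp
    qed (use B in auto)
    also have "\<dots> \<le> (S * D * D * J + 1) * Q" using \<open>0 \<le> Q\<close> by (simp add: algebra_simps)
    finally show ?thesis .
  qed
  show thesis
  proof (rule that[of "S * D * D * A" "S * D * D * J + 1" \<alpha> \<beta> \<epsilon>])
    show "S * D * D * J + 1 > 0" using S B J by (intro add_nonneg_pos) auto
    show "norm (L2_inner (fourier_multiplier \<sigma> (tf_shift (x, \<xi>) g)) (tf_shift (y, \<eta>) g))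
        \<le> S * D * D * A * exp (- \<alpha> * norm (x - y) powr (1/\<mu>))" for x \<xi> y \<eta>
      unfolding entry by (rule A(3)[OF \<Phi>_gev])
  qed (use S B A frequency entry in auto)
qed

theorem theorem4p5:
  fixes \<mu> :: real and \<nu> :: ereal and \<sigma> g :: "real ^ 'd::finite \<Rightarrow> complex"
  assumes "1/2 \<le> \<mu>" and "ereal (1/2) \<le> \<nu>"
    and "\<sigma> \<in> gelfand_shilov \<mu> \<nu>"
    and "g \<in> gelfand_shilov (1/2) (ereal (1/2))"
  shows "(\<nu> = \<infinity> \<longrightarrow>
      (\<exists>C>0. \<exists>\<epsilon>>0. \<forall>z w :: (real ^ 'd) \<times> (real ^ 'd).
        norm (L2_inner (fourier_multiplier \<sigma> (tf_shift z g)) (tf_shift w g))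
          \<le> C * exp (- \<epsilon> * norm (w - z) powr (1 / \<mu>))))
    \<and> (\<nu> < \<infinity> \<longrightarrow>
      (\<exists>C>0. \<exists>\<epsilon>>0. \<forall>x \<xi> y \<eta> :: real ^ 'd.
        norm (L2_inner (fourier_multiplier \<sigma> (tf_shift (x, \<xi>) g)) (tf_shift (y, \<eta>) g))
          \<le> C * exp (- \<epsilon> * ((norm \<xi>)\<^sup>2 + (norm \<eta>)\<^sup>2) powr (min (1 / real_of_ereal \<nu>) (1 / \<mu>) / 2))
              * exp (- \<epsilon> * norm (x - y) powr (1 / \<mu>))))"
proof -
  define p where "p = 1 / \<mu>"
  have p: "0 \<le> p" "p \<le> 2" using assms(1) by (auto simp: p_def field_simps)
  obtain K L \<alpha> \<beta> \<epsilon> where pos: "K > 0" "L > 0" "\<alpha> > 0" "\<beta> > 0" "\<epsilon> > 0"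
    and time: "\<And>x \<xi> y \<eta>. norm (L2_inner (fourier_multiplier \<sigma> (tf_shift (x, \<xi>) g)) (tf_shift (y, \<eta>) g))
        \<le> K * exp (- \<alpha> * norm (x - y) powr p)"
    and freq: "\<And>x \<xi> y \<eta> Q. (\<And>\<zeta>. decay_weight \<beta> \<nu> \<zeta> *
          (exp (- (\<epsilon>/2) * (norm (\<zeta> - \<xi>))\<^sup>2) * exp (- (\<epsilon>/2) * (norm (\<zeta> - \<eta>))\<^sup>2)) \<le> Q)
      \<Longrightarrow> norm (L2_inner (fourier_multiplier \<sigma> (tf_shift (x, \<xi>) g)) (tf_shift (y, \<eta>) g)) \<le> L * Q"
    unfolding p_def using gabor_matrix_two_bounds[OF assms(1,3,4)] by metis
  have "\<exists>C>0. \<exists>\<epsilon>>0. \<forall>z w :: (real ^ 'd) \<times> (real ^ 'd).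
        norm (L2_inner (fourier_multiplier \<sigma> (tf_shift z g)) (tf_shift w g))
          \<le> C * exp (- \<epsilon> * norm (w - z) powr p)" if "\<nu> = \<infinity>"
  proof -
    \<comment> \<open>The final rate is \<open>\<kappa>/8\<close>: a factor \<open>2\<close> is lost in combining the two bounds and a factor \<open>4\<close> in
      splitting \<open>|w - z|\<^sup>p\<close> into time and frequency parts.\<close>
    define \<kappa> where "\<kappa> = min \<alpha> (\<epsilon>/8)"
    have \<kappa>: "\<kappa> > 0" "\<kappa> \<le> \<alpha>" "\<kappa> \<le> \<epsilon>/8" using pos by (auto simp: \<kappa>_def)
    have "norm (L2_inner (fourier_multiplier \<sigma> (tf_shift (x, \<xi>) g)) (tf_shift (y, \<eta>) g))
          \<le> (K + L * exp \<epsilon>) * exp (- (\<kappa>/8) * norm ((y, \<eta>) - (x, \<xi>)) powr p)" for x \<xi> y \<eta>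
    proof -
      let ?X = "norm (L2_inner (fourier_multiplier \<sigma> (tf_shift (x, \<xi>) g)) (tf_shift (y, \<eta>) g))"
      let ?s = "norm (x - y) powr p" and ?t = "norm (\<xi> - \<eta>) powr p"
      have "?X \<le> L * (exp \<epsilon> * exp (- (\<epsilon>/8) * ?t))"
        using frequency_difference_decay[OF pos(5) p] \<open>\<nu> = \<infinity>\<close>
        by (intro freq) (simp add: decay_weight_def)
      then have "?X \<le> (K + L * exp \<epsilon>) * exp (- ((\<alpha> * ?s + (\<epsilon>/8) * ?t) / 2))"
        using time[of x \<xi> y \<eta>] pos by (intro interpolate_exp_bounds) (auto simp: mult.assoc)
      also have "\<dots> \<le> (K + L * exp \<epsilon>) * exp (- (\<kappa>/8) * norm ((y, \<eta>) - (x, \<xi>)) powr p)"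
      proof -
        have "norm ((y, \<eta>) - (x, \<xi>)) \<le> norm (x - y) + norm (\<xi> - \<eta>)"
          using norm_Pair_le[of "y - x" "\<eta> - \<xi>"] by (simp add: norm_minus_commute)
        then have "norm ((y, \<eta>) - (x, \<xi>)) powr p \<le> (norm (x - y) + norm (\<xi> - \<eta>)) powr p"
          using p by (intro powr_mono2) auto
        also have "\<dots> \<le> 4 * (?s + ?t)" using p by (intro powr_add_le) auto
        finally have "(\<kappa>/8) * norm ((y, \<eta>) - (x, \<xi>)) powr p \<le> (\<kappa>/8) * (4 * (?s + ?t))"
          using \<kappa> by (intro mult_left_mono) auto
        also have "\<dots> = (\<kappa> * ?s + \<kappa> * ?t) / 2" by (simp add: algebra_simps)
        also have "\<dots> \<le> (\<alpha> * ?s + (\<epsilon>/8) * ?t) / 2"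
          using \<kappa> by (intro divide_right_mono add_mono mult_right_mono) auto
        finally show ?thesis using pos by (intro mult_left_mono) auto
      qed
      finally show ?thesis .
    qed
    then show ?thesis
      using pos \<kappa> by (intro exI[of _ "K + L * exp \<epsilon>"] exI[of _ "\<kappa>/8"] conjI) (auto intro: add_pos_pos)
  qed
  moreover have "\<exists>C>0. \<exists>\<epsilon>>0. \<forall>x \<xi> y \<eta> :: real ^ 'd.
        norm (L2_inner (fourier_multiplier \<sigma> (tf_shift (x, \<xi>) g)) (tf_shift (y, \<eta>) g))
          \<le> C * exp (- \<epsilon> * ((norm \<xi>)\<^sup>2 + (norm \<eta>)\<^sup>2) powr (min (1 / real_of_ereal \<nu>) p / 2))
              * exp (- \<epsilon> * norm (x - y) powr p)" if fin: "\<nu> < \<infinity>"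
  proof -
    define q where "q = 1 / real_of_ereal \<nu>"
    define \<rho> where "\<rho> = min q p"
    obtain n where n: "\<nu> = ereal n" using fin assms(2) by (cases \<nu>) auto
    then have "1/2 \<le> n" using assms(2) by simp
    then have q: "0 \<le> q" "q \<le> 2" using n by (auto simp: q_def field_simps)
    have \<rho>: "0 \<le> \<rho>" "\<rho> \<le> q" using p q by (auto simp: \<rho>_def)
    \<comment> \<open>The largest rate that the pointwise frequency bound admits.\<close>
    define \<kappa> where "\<kappa> = min (\<epsilon>/2) (\<beta>/2)"
    have \<kappa>: "\<kappa> > 0" "\<kappa> \<le> \<epsilon>/2" "2 * \<kappa> \<le> \<beta>" using pos by (auto simp: \<kappa>_def)
    \<comment> \<open>The smaller of the two rates, halved by the combination of the bounds.\<close>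
    define \<tau> where "\<tau> = min \<alpha> (\<kappa>/16) / 2"
    have \<tau>: "\<tau> > 0" "\<tau> \<le> \<alpha>/2" "\<tau> \<le> \<kappa>/16/2" using pos \<kappa> by (auto simp: \<tau>_def)
    have "norm (L2_inner (fourier_multiplier \<sigma> (tf_shift (x, \<xi>) g)) (tf_shift (y, \<eta>) g))
          \<le> (K + L * exp (4*\<kappa>)) * exp (- \<tau> * ((norm \<xi>)\<^sup>2 + (norm \<eta>)\<^sup>2) powr (\<rho> / 2))
              * exp (- \<tau> * norm (x - y) powr p)" for x \<xi> y \<eta>
    proof -
      let ?X = "norm (L2_inner (fourier_multiplier \<sigma> (tf_shift (x, \<xi>) g)) (tf_shift (y, \<eta>) g))"
      let ?s = "norm (x - y) powr p" and ?t = "((norm \<xi>)\<^sup>2 + (norm \<eta>)\<^sup>2) powr (\<rho> / 2)"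
      have "?X \<le> L * (exp (4*\<kappa>) * exp (- (\<kappa>/16) * ?t))"
        using frequency_decay[OF \<kappa> \<rho> q(2)] n
        by (intro freq) (simp add: decay_weight_def q_def)
      then have "?X \<le> (K + L * exp (4*\<kappa>)) * exp (- ((\<alpha> * ?s + (\<kappa>/16) * ?t) / 2))"
        using time[of x \<xi> y \<eta>] pos by (intro interpolate_exp_bounds) (auto simp: mult.assoc)
      also have "\<dots> \<le> (K + L * exp (4*\<kappa>)) * exp (- (\<tau> * ?s + \<tau> * ?t))"
      proof -
        have "\<tau> * ?s + \<tau> * ?t \<le> \<alpha>/2 * ?s + \<kappa>/16/2 * ?t"
          using \<tau> by (intro add_mono mult_right_mono) auto
        then have "\<tau> * ?s + \<tau> * ?t \<le> (\<alpha> * ?s + (\<kappa>/16) * ?t) / 2" by simp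
        then have "exp (- ((\<alpha> * ?s + (\<kappa>/16) * ?t) / 2)) \<le> exp (- (\<tau> * ?s + \<tau> * ?t))"
          by (simp only: exp_le_cancel_iff neg_le_iff_le)
        then show ?thesis using pos by (intro mult_left_mono) auto
      qed
      also have "\<dots> = (K + L * exp (4*\<kappa>)) * exp (- \<tau> * ?t) * exp (- \<tau> * ?s)"
        by (simp add: mult.assoc exp_add[symmetric])
      finally show ?thesis .
    qed
    then show ?thesis unfolding q_def[symmetric] \<rho>_def[symmetric]
      using pos \<tau> by (intro exI[of _ "K + L * exp (4*\<kappa>)"] exI[of _ \<tau>] conjI) (auto intro: add_pos_pos)
  qed
  ultimately show ?thesis unfolding p_def by blast
qed

end
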